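(* Let $p$ be a prime with $p \equiv 1 \pmod 3$, let $q = p^{p-1}$, and let $E/\mathbb{F}_p$ be the elliptic curve $y^2 = x^3 - 1$. Then the following three conditions are equivalent: (1) $p$ is $1$-exceptional for $m = 3$; (2) $G_{p-1} \equiv 0 \pmod{p^2}$; (3) $\#E(\mathbb{F}_q) \equiv 0 \pmod{p^2}$. Here $\{G_n\}$ are the Glaisher numbers, given by \[ \frac{3/2}{e^x + e^{-x} + 1} = \sum_{n=0}^{\infty} G_n \frac{x^n}{n!}. \]
   Context: For a prime $p$ and a positive integer $m$ with $p \equiv 1 \pmod m$, the prime $p$ is called $1$-exceptional for $m$ if \[ \prod_{\substack{1 \le a \le (p^2-1)/m \\ \gcd(a,p)=1}} a^{p-1} \equiv 1 \pmod{p^2}. \] The $G_n$ are rational numbers; the congruence $G_{p-1} \equiv 0 \pmod{p^2}$ is understood in the ring of $p$-integral rational numbers. *)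

theory Defs
  imports
    "HOL-Algebra.Ring"
    "HOL-Number_Theory.Cong"
    "HOL-Computational_Algebra.Formal_Power_Series"
begin

text \<open>
  Meant for a prime \<open>p\<close> and \<open>m > 0\<close> with \<open>p \<equiv> 1 (mod m)\<close>; then \<open>m\<close> divides
  \<open>p\<^sup>2 - 1\<close>, so \<open>div\<close> is exact.
\<close>
definition one_exceptional :: "nat \<Rightarrow> nat \<Rightarrow> bool" where
  "one_exceptional p m \<longleftrightarrow>
     [(\<Prod>a | 1 \<le> a \<and> a \<le> (p^2 - 1) div m \<and> coprime a p. a ^ (p - 1)) = 1] (mod p^2)"

text \<open>
  The generating function is read as an identity of formal power series over the rationals; the
  denominator has constant term 3, so it is a unit and \<open>/\<close> is the true quotient.
\<close>
definition glaisher :: "nat \<Rightarrow> rat" where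
  "glaisher n = fact n *
     fps_nth (fps_const (3 / 2) / (fps_exp 1 + fps_exp (- 1) + 1)) n"

definition p_integral :: "nat \<Rightarrow> rat \<Rightarrow> bool" where
  "p_integral p x \<longleftrightarrow> coprime (snd (quotient_of x)) (int p)"

definition p_integral_cong :: "nat \<Rightarrow> rat \<Rightarrow> rat \<Rightarrow> nat \<Rightarrow> bool" where
  "p_integral_cong p x y n \<longleftrightarrow> p_integral p x \<and> p_integral p y \<and>
     (\<exists>z. p_integral p z \<and> x - y = of_nat n * z)"

text \<open>
  Points over \<open>K\<close> of the curve \<open>y\<^sup>2 = x\<^sup>3 + a x + b\<close>; \<open>None\<close> is the point at infinity.
\<close>
definition weierstrass_points ::
    "('a, 'b) ring_scheme \<Rightarrow> 'a \<Rightarrow> 'a \<Rightarrow> ('a \<times> 'a) option set" where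
  "weierstrass_points K a b = insert None
     {Some (x, y) | x y. x \<in> carrier K \<and> y \<in> carrier K \<and>
        y [^]\<^bsub>K\<^esub> (2::nat) = x [^]\<^bsub>K\<^esub> (3::nat) \<oplus>\<^bsub>K\<^esub> a \<otimes>\<^bsub>K\<^esub> x \<oplus>\<^bsub>K\<^esub> b}"

end

theory Submission
  imports Defs "HOL-Number_Theory.Number_Theory" "HOL-Computational_Algebra.Polynomial"
begin

text \<open>
  Write \<open>p = 3c + 1\<close>, \<open>q = p\<^bsup>p - 1\<^esup>\<close>, \<open>m = (q - 1)/3\<close>, \<open>N = (p\<^sup>2 - 1)/3\<close>, and let \<open>P(n)\<close> be the product
  of the numbers up to \<open>n\<close> that are prime to \<open>p\<close>. The first condition says
  \<open>P(N)\<^bsup>p - 1\<^esup> \<equiv> 1 (mod p\<^sup>2)\<close>, and each of the other two is compared with it.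

  Glaisher numbers. The series \<open>1 / (e\<^sup>x + e\<^bsup>-x\<^esup> + 1)\<close> equals \<open>(e\<^bsup>2x\<^esup> - e\<^sup>x) / (e\<^bsup>3x\<^esup> - 1)\<close>, and power sums over
  \<open>0, 3, \<dots>, 3N\<close> have the same denominator. Comparing coefficients (\<open>glaisher_cong\<close>) gives
  \<open>G\<^bsub>p - 1\<^esub> \<equiv> 3\<^bsup>p - 1\<^esup> (3 \<Sum>i\<^bsup>p - 1\<^esup> + p) (mod p\<^sup>2)\<close>, the sum being over \<open>i \<le> N\<close>. Since each \<open>a\<^bsup>p - 1\<^esup>\<close> with \<open>a\<close>
  prime to \<open>p\<close> is 1 modulo \<open>p\<close>, the right-hand side vanishes exactly when the product of these powers
  is 1 modulo \<open>p\<^sup>2\<close>.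

  Points as binomial sums. Over the field with \<open>q\<close> elements \<open>-1\<close> is a square and 4 is a cube, so the
  curve takes the form \<open>x\<^sup>3 = z (1 - z)\<close> and has \<open>q + 1\<close> points plus the two cubic Jacobi sums
  \<open>\<Sum>\<psi>(z) \<psi>(1 - z)\<close>. To evaluate them modulo \<open>p\<^sup>2\<close>, the characters are realised by Teichmueller lifts
  in a ring of characteristic \<open>p\<^sup>2\<close> above the field. Instead of Witt vectors, integer polynomials
  modulo a suitable ideal are used (\<open>witt_null\<close>). As \<open>p\<close>-th powers of lifts depend only on residues,
  \<open>1 - z\<close> can be lifted naively before raising to a multiple of \<open>p\<close>, and the binomial theorem turns
  the Jacobi sums into sums of binomial coefficients (\<open>card_weierstrass_points_cong\<close>). One of them
  vanishes modulo \<open>p\<^sup>2\<close>; the other is \<open>-J\<close> with \<open>J = \<Sum>\<^sub>j C(2pm, (3j + 1)m)\<close>, so the number of points is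
  \<open>1 - J\<close>.

  The unit root. By Lucas' theorem, \<open>J \<cdot> C(2c, c)\<close> matches term by term a Vandermonde expansion of
  \<open>C(2M, M)\<close> with \<open>M = pm + c = (p\<^sup>p - 1)/3\<close> (\<open>jacobi_sum_cong\<close>); this takes the place of the
  Hasse--Davenport and Gross--Koblitz theorems. Removing the multiples of \<open>p\<close> from the factorials, one
  digit of \<open>M\<close> after the other, expresses \<open>C(2M, M) / C(2c, c)\<close> as a product of \<open>p - 1\<close> quotients
  \<open>P(2N) / P(N)\<^sup>2\<close>, and \<open>P(2N) \<equiv> \<plusminus>1 / P(N)\<close> by reflection (\<open>central_choose_third_trunc_cong\<close>,
  \<open>coprime_fact_third_mult\<close>). Hence \<open>J \<cdot> P(N)\<^bsup>3(p - 1)\<^esup> \<equiv> 1\<close>, and \<open>J \<equiv> 1\<close> if and only if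
  \<open>P(N)\<^bsup>p - 1\<^esup> \<equiv> 1\<close>.
\<close>

section \<open>Binomial coefficients modulo a prime and its square\<close>

lemma prime_choose_cong_0:
  assumes "Factorial_Ring.prime (p::nat)" "0 < i" "i < p"
  shows "[p choose i = 0] (mod p)"
  using assms by (simp add: cong_0_iff dvd_choose_prime)

text \<open>
  The congruence \<open>(1 + X)\<^sup>p \<equiv> 1 + X\<^sup>p\<close> read off in the coefficients of \<open>(1 + X)\<^bsup>p + n\<^esup>\<close>; it is
  the Pascal rule for the next-to-last digit that drives Lucas' theorem below.
\<close>
lemma choose_add_prime_cong:
  assumes p: "Factorial_Ring.prime (p::nat)"
  shows "[(p + n) choose k = (n choose k) + (if p \<le> k then n choose (k - p) else 0)] (mod p)"
proof -
  have "(p + n) choose k = (\<Sum>i\<le>k. (p choose i) * (n choose (k - i)))"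
    by (simp add: vandermonde)
  also have "[\<dots> = (\<Sum>i\<le>k. if i = 0 \<or> i = p then n choose (k - i) else 0)] (mod p)"
  proof (rule cong_sum)
    fix i
    show "[(p choose i) * (n choose (k - i)) = (if i = 0 \<or> i = p then n choose (k - i) else 0)] (mod p)"
      using prime_choose_cong_0[OF p, of i] cong_mult[of "p choose i" 0 p "n choose (k - i)" "n choose (k - i)"]
      by (cases "i = 0 \<or> i = p"; cases "i < p") (auto simp: binomial_eq_0)
  qed
  also have "(\<Sum>i\<le>k. if i = 0 \<or> i = p then n choose (k - i) else 0)
      = (\<Sum>i\<in>{..k} \<inter> {0, p}. n choose (k - i))"
    by (subst sum.inter_restrict) auto
  also have "\<dots> = (n choose k) + (if p \<le> k then n choose (k - p) else 0)"
    using prime_gt_0_nat[OF p] by (cases "p \<le> k") (auto simp: Int_insert_right)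
  finally show ?thesis .
qed

lemma lucas_last_digit:
  assumes p: "Factorial_Ring.prime (p::nat)" and b: "b < p" and d: "d < p"
  shows "[(p * a + b) choose (p * c + d) = (a choose c) * (b choose d)] (mod p)"
proof (induction a arbitrary: c)
  case 0
  show ?case
  proof (cases c)
    case (Suc c')
    then have "b < p * c + d" using b by simp
    then show ?thesis using Suc by (simp add: binomial_eq_0)
  qed simp
next
  case (Suc a)
  have *: "p * Suc a + b = p + (p * a + b)" by simp
  have "[(p * Suc a + b) choose (p * c + d) = ((p * a + b) choose (p * c + d))
     + (if p \<le> p * c + d then (p * a + b) choose (p * c + d - p) else 0)] (mod p)"
    unfolding * by (rule choose_add_prime_cong[OF p])
  also have "[((p * a + b) choose (p * c + d))
     + (if p \<le> p * c + d then (p * a + b) choose (p * c + d - p) else 0)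
     = (Suc a choose c) * (b choose d)] (mod p)"
  proof (cases c)
    case 0
    then show ?thesis using Suc.IH[of 0] d by simp
  next
    case (Suc c')
    have "p * c + d - p = p * c' + d" using Suc by simp
    then show ?thesis
      using cong_add[OF Suc.IH[of c] Suc.IH[of c']] Suc by (simp add: algebra_simps)
  qed
  finally show ?case .
qed

text \<open>
  Lucas' theorem for splitting off the top block of base-\<open>p\<close> digits instead of the last digit.
\<close>
lemma lucas_top_digit:
  assumes p: "Factorial_Ring.prime (p::nat)"
  shows "b < p ^ k \<Longrightarrow> d < p ^ k \<Longrightarrow>
    [(a * p ^ k + b) choose (c * p ^ k + d) = (a choose c) * (b choose d)] (mod p)"
proof (induction k arbitrary: b d)
  case (Suc k)
  have p0: "p > 0" using prime_gt_0_nat[OF p] .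
  have lt: "b div p < p ^ k" "d div p < p ^ k"
    using Suc.prems by (simp_all add: less_mult_imp_div_less mult.commute)
  have b: "a * p ^ Suc k + b = p * (a * p ^ k + b div p) + b mod p"
   and d: "c * p ^ Suc k + d = p * (c * p ^ k + d div p) + d mod p"
    by (simp_all add: algebra_simps)
  have "[(a * p ^ Suc k + b) choose (c * p ^ Suc k + d)
      = (a * p ^ k + b div p choose (c * p ^ k + d div p)) * (b mod p choose (d mod p))] (mod p)"
    unfolding b d using p0 by (intro lucas_last_digit[OF p]) auto
  also have "[(a * p ^ k + b div p choose (c * p ^ k + d div p)) * (b mod p choose (d mod p))
      = (a choose c) * (b div p choose (d div p)) * (b mod p choose (d mod p))] (mod p)"
    using Suc.IH[OF lt] by (intro cong_mult) auto
  also have "[(a choose c) * (b div p choose (d div p)) * (b mod p choose (d mod p))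
      = (a choose c) * ((p * (b div p) + b mod p) choose (p * (d div p) + d mod p))] (mod p)"
    unfolding mult.assoc using p0
    by (intro cong_mult cong_refl cong_sym[OF lucas_last_digit[OF p]]) auto
  finally show ?case by simp
qed auto

lemma choose_pred_last_digit_cong:
  assumes p: "Factorial_Ring.prime (p::nat)" and M: "M > 0"
  shows "[(p * M - 1) choose x = (M - 1 choose (x div p)) * (p - 1 choose (x mod p))] (mod p)"
proof -
  have p0: "p > 0" using prime_gt_0_nat[OF p] .
  have "p * M - 1 = p * (M - 1) + (p - 1)"
    using M p0 by (cases M) (auto simp: diff_mult_distrib2)
  then show ?thesis
    using lucas_last_digit[OF p, of "p - 1" "x mod p" "M - 1" "x div p"] p0 by simp
qed

text \<open>
  For \<open>x\<close> prime to \<open>p\<close> the absorption identity \<open>x * C(pM, x) = pM * C(pM - 1, x - 1)\<close> gives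
  \<open>C(pM, x)\<close> modulo \<open>p\<^sup>2\<close> out of \<open>x\<close> and \<open>C(pM - 1, x - 1)\<close> modulo \<open>p\<close>, and Lucas reduces
  the latter to the digits of \<open>x - 1\<close>.
\<close>
lemma choose_mult_prime_cong:
  assumes p: "Factorial_Ring.prime (p::nat)" and M: "M > 0"
    and x: "0 < x" "\<not> p dvd x" and y: "0 < y" and xy: "[x = y] (mod p)"
    and AB: "[(M - 1 choose ((x - 1) div p)) * A = (M - 1 choose ((y - 1) div p)) * B] (mod p)"
  shows "[(p * M choose x) * A = (p * M choose y) * B] (mod p\<^sup>2)"
proof -
  have p0: "p > 0" using prime_gt_0_nat[OF p] .
  have y': "\<not> p dvd y" using xy x(2) cong_dvd_iff by blast
  define U V where "U = (p * M choose x) * A" and "V = (p * M choose y) * B"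
  define \<alpha> \<beta> where "\<alpha> = (p * M - 1 choose (x - 1)) * A" and "\<beta> = (p * M - 1 choose (y - 1)) * B"
  have "[(x - 1) mod p = (y - 1) mod p] (mod p)"
    using xy x(1) y by (metis Suc_diff_1 Suc_eq_plus1 cong_add_rcancel_nat cong_mod_left cong_mod_right)
  then have mods: "(x - 1) mod p = (y - 1) mod p"
    by (simp add: Cong.cong_def)
  have \<alpha>\<beta>: "[\<alpha> = \<beta>] (mod p)"
  proof -
    have "[\<alpha> = (M - 1 choose ((x - 1) div p)) * (p - 1 choose ((x - 1) mod p)) * A] (mod p)"
      unfolding \<alpha>_def by (intro cong_mult cong_refl choose_pred_last_digit_cong[OF p M])
    also have "(M - 1 choose ((x - 1) div p)) * (p - 1 choose ((x - 1) mod p)) * A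
      = (M - 1 choose ((x - 1) div p)) * A * (p - 1 choose ((y - 1) mod p))"
      unfolding mods by simp
    also have "[\<dots> = (M - 1 choose ((y - 1) div p)) * B * (p - 1 choose ((y - 1) mod p))] (mod p)"
      by (intro cong_mult AB cong_refl)
    also have "(M - 1 choose ((y - 1) div p)) * B * (p - 1 choose ((y - 1) mod p))
       = (M - 1 choose ((y - 1) div p)) * (p - 1 choose ((y - 1) mod p)) * B" by simp
    also have "[\<dots> = \<beta>] (mod p)"
      unfolding \<beta>_def by (intro cong_mult cong_refl cong_sym[OF choose_pred_last_digit_cong[OF p M]])
    finally show ?thesis .
  qed
  have xU: "x * U = p * (M * \<alpha>)" and yV: "y * V = p * (M * \<beta>)"
    unfolding U_def V_def \<alpha>_def \<beta>_def
    using times_binomial_minus1_eq[of x "p * M"] times_binomial_minus1_eq[of y "p * M"] x y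
    by (simp_all add: algebra_simps)
  have "[x * U = y * V] (mod p\<^sup>2)"
    unfolding xU yV power2_eq_square cong_iff_dvd_diff
    using cong_scalar_left[OF \<alpha>\<beta>, of M] by (simp add: cong_def flip: mult_mod_right)
  moreover have "[y * V = x * V] (mod p\<^sup>2)"
  proof -
    have "p dvd y * V" unfolding yV by simp
    then have "p dvd V" using y' p prime_dvd_mult_iff by blast
    then obtain v where v: "V = p * v" by blast
    have "[y * v = x * v] (mod p)" using xy by (intro cong_mult) (auto simp: cong_sym)
    then show ?thesis unfolding v power2_eq_square
      by (simp add: cong_def mult.left_commute[of _ p] flip: mult_mod_right)
  qed
  ultimately have "[x * U = x * V] (mod p\<^sup>2)" by (rule cong_trans)
  moreover have "coprime x (p\<^sup>2)"
    using x(2) p by (simp add: prime_imp_coprime coprime_commute)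
  ultimately show ?thesis unfolding U_def V_def
    by (simp add: cong_mult_lcancel_nat)
qed

text \<open>
  Both lower indices are congruent to \<open>c - j\<close> modulo \<open>p\<close>, and Lucas' theorem applied to the top
  digit (the block \<open>Q\<close>) makes both sides the same product of three binomial coefficients. The
  borrow \<open>\<epsilon>\<close> from the last digit is the same on both sides as well.
\<close>
lemma jacobi_sum_term_cong:
  fixes p c Q e m1 j :: nat
  assumes p: "Factorial_Ring.prime p" and pc: "p = 3 * c + 1" and c: "c > 0"
    and Q: "Q = p ^ e" "Q = 3 * m1 + 1" "m1 > 0" and m: "m = p * m1 + c" and j: "j \<le> 2 * c"
  shows "[(p * (2 * m) choose ((3 * j + 1) * m)) * (2 * c choose c)
        = (p * (2 * m) choose (p * m + c - j)) * (2 * c choose j)] (mod p\<^sup>2)"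
proof (cases "j = c")
  case True
  then show ?thesis using pc by simp
next
  case False
  have mQ: "m = c * Q + m1" unfolding m Q(2) pc by (simp add: algebra_simps)
  have m0: "m > 0" using m c by simp
  have pm: "p * m \<ge> p * 1" using m0 by (intro mult_le_mono) auto
  have jm: "(3 * j + 1) * m = p * (j * Q + m1) + c - j"
  proof -
    have "(3 * j + 1) * m + j = p * (j * Q + m1) + c"
      unfolding m Q(2) pc by (simp add: algebra_simps)
    then show ?thesis by simp
  qed
  define \<epsilon> where "\<epsilon> = (if j < c then 0 else 1 :: nat)"
  have \<epsilon>: "\<epsilon> \<le> m1" using Q(3) by (simp add: \<epsilon>_def)
  \<comment> \<open>the two lower indices have the same last digit and, above it, the same carry\<close>
  have digits: "(p * k + c - j - 1) div p = k - \<epsilon>" "0 < p * k + c - j"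
      "\<not> p dvd p * k + c - j" if k: "k > 0" for k
  proof -
    have "p * k + c - j = p * k + (c - j) \<and> c - j - 1 < p \<and> 0 < c - j \<and> c - j < p \<and> \<epsilon> = 0" if "j < c"
      using that pc by (simp add: \<epsilon>_def) arith
    moreover have "p * k + c - j = p * (k - 1) + (p - (j - c)) \<and> p - (j - c) - 1 < p
        \<and> 0 < p - (j - c) \<and> p - (j - c) < p \<and> \<epsilon> = 1" if "\<not> j < c"
    proof -
      have "p * k = p * (k - 1) + p" using k by (cases k) auto
      then show ?thesis using that pc j False by (simp add: \<epsilon>_def) arith
    qed
    ultimately obtain k' r where kr: "p * k + c - j = p * k' + r" "0 < r" "r < p" "k' = k - \<epsilon>"
      by (metis diff_zero)
    have "(p * k' + r - 1) div p = k'"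
    proof -
      have "p * k' + r - 1 = (r - 1) + p * k'" using kr by simp
      then show ?thesis using kr by (simp only: div_mult_self2) simp
    qed
    moreover have "\<not> p dvd p * k' + r"
      using kr by (metis dvd_add_right_iff dvd_triv_left nat_dvd_not_less)
    ultimately show "(p * k + c - j - 1) div p = k - \<epsilon>" "0 < p * k + c - j"
      "\<not> p dvd p * k + c - j" using kr by auto
  qed
  have top: "2 * m - 1 = (2 * c) * Q + (2 * m1 - 1)"
    using Q(3) unfolding mQ by simp
  have lucas: "[(2 * m - 1 choose (l * Q + m1 - \<epsilon>))
      = (2 * c choose l) * (2 * m1 - 1 choose (m1 - \<epsilon>))] (mod p)" for l
  proof -
    have "l * Q + m1 - \<epsilon> = l * Q + (m1 - \<epsilon>)" using \<epsilon> by simp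
    then show ?thesis
      unfolding top using lucas_top_digit[OF p, of "2 * m1 - 1" e "m1 - \<epsilon>" "2 * c" l] Q
      by auto
  qed
  have x0: "j * Q + m1 > 0" using Q by simp
  have D: "(2 * m - 1 choose (((3 * j + 1) * m - 1) div p)) = (2 * m - 1 choose (j * Q + m1 - \<epsilon>))"
     "(2 * m - 1 choose ((p * m + c - j - 1) div p)) = (2 * m - 1 choose (c * Q + m1 - \<epsilon>))"
    unfolding jm digits(1)[OF x0] digits(1)[OF m0] by (simp_all add: mQ)
  show ?thesis
  proof (rule choose_mult_prime_cong[OF p])
    show "0 < 2 * m" using m0 by simp
    show "0 < (3 * j + 1) * m" "\<not> p dvd (3 * j + 1) * m"
      unfolding jm using digits[OF x0] by auto
    show "0 < p * m + c - j" using digits(2)[OF m0] .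
    show "[(3 * j + 1) * m = p * m + c - j] (mod p)"
    proof -
      have "[(3 * j + 1) * m + j = p * m + c - j + j] (mod p)"
      proof -
        have "(3 * j + 1) * m + j = p * (j * Q + m1) + c" "p * m + c - j + j = p * m + c"
          using jm digits(2)[OF x0] digits(2)[OF m0] by auto
        then show ?thesis by (simp add: Cong.cong_def)
      qed
      then show ?thesis using cong_add_rcancel_nat by blast
    qed
    have "[(2 * m - 1 choose (j * Q + m1 - \<epsilon>)) * (2 * c choose c)
        = (2 * c choose j) * (2 * m1 - 1 choose (m1 - \<epsilon>)) * (2 * c choose c)] (mod p)"
      by (intro cong_mult lucas cong_refl)
    moreover have "[(2 * m - 1 choose (c * Q + m1 - \<epsilon>)) * (2 * c choose j)
        = (2 * c choose c) * (2 * m1 - 1 choose (m1 - \<epsilon>)) * (2 * c choose j)] (mod p)"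
      by (intro cong_mult lucas cong_refl)
    ultimately show "[(2 * m - 1 choose (((3 * j + 1) * m - 1) div p)) * (2 * c choose c)
       = (2 * m - 1 choose ((p * m + c - j - 1) div p)) * (2 * c choose j)] (mod p)"
      unfolding D Cong.cong_def by (simp add: mult_ac)
  qed
qed

text \<open>
  Multiplied by \<open>C(2c, c)\<close>, the sum agrees term by term with the Vandermonde convolution of
  \<open>(1 + X)\<^bsup>2pm\<^esup>\<close> and \<open>(1 + X)\<^bsup>2c\<^esup>\<close>. This is the analogue modulo \<open>p\<^sup>2\<close> of multiplying a power of
  the Jacobi sum over the prime field by one more factor.
\<close>
lemma jacobi_sum_cong:
  fixes p c Q e m1 :: nat
  assumes p: "Factorial_Ring.prime p" and pc: "p = 3 * c + 1" and c: "c > 0"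
    and Q: "Q = p ^ e" "Q = 3 * m1 + 1" "m1 > 0" and m: "m = p * m1 + c"
  shows "[(\<Sum>j\<le>2*c. p * (2 * m) choose ((3 * j + 1) * m)) * (2 * c choose c)
        = (2 * (p * m + c)) choose (p * m + c)] (mod p\<^sup>2)"
proof -
  have "[(\<Sum>j\<le>2*c. (p * (2 * m) choose ((3 * j + 1) * m)) * (2 * c choose c))
     = (\<Sum>j\<le>2*c. (p * (2 * m) choose (p * m + c - j)) * (2 * c choose j))] (mod p\<^sup>2)"
    by (intro cong_sum jacobi_sum_term_cong[OF assms]) auto
  also have "(\<Sum>j\<le>2*c. (p * (2 * m) choose (p * m + c - j)) * (2 * c choose j))
      = (\<Sum>j\<le>p*m+c. (p * (2 * m) choose (p * m + c - j)) * (2 * c choose j))"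
  proof (rule sum.mono_neutral_left)
    have "p * m \<ge> p * 1" using m c by (intro mult_le_mono) auto
    then show "{..2 * c} \<subseteq> {..p * m + c}" using pc by auto
  qed (auto simp: binomial_eq_0)
  also have "\<dots> = (2 * c + p * (2 * m)) choose (p * m + c)"
    unfolding vandermonde[of "2 * c" "p * (2 * m)", symmetric] by (simp add: mult.commute)
  finally show ?thesis
    unfolding sum_distrib_right[symmetric] by (simp add: distrib_left mult.left_commute add.commute)
qed

text \<open>
  The conjugate Jacobi sum has positive \<open>p\<close>-adic valuation at every digit. Two digits already
  suffice for \<open>p\<^sup>2\<close>: one factor \<open>p\<close> comes from the absorption identity, the other from a
  binomial coefficient in Lucas' theorem whose lower entry exceeds its upper one.
\<close>
lemma conjugate_jacobi_sum_term_cong_0: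
  fixes p c Q e m1 j :: nat
  assumes p: "Factorial_Ring.prime p" and pc: "p = 3 * c + 1"
    and Q: "Q = p ^ e" "Q = 3 * m1 + 1" "m1 > 0" and m: "m = p * m1 + c" and j: "j < c"
  shows "[p * m choose ((3 * j + 2) * m) = 0] (mod p\<^sup>2)"
proof -
  have mQ: "m = c * Q + m1" unfolding m Q(2) pc by (simp add: algebra_simps)
  have m0: "m > 0" using m j by simp
  have jm: "(3 * j + 2) * m = p * (j * Q + 2 * m1) + (2 * c - j)"
  proof -
    have "(3 * j + 2) * m + j = p * (j * Q + 2 * m1) + 2 * c"
      unfolding m Q(2) pc by (simp add: algebra_simps)
    then show ?thesis using j by simp
  qed
  have r: "0 < 2 * c - j" "2 * c - j < p" using j pc by auto
  have "0 < (3 * j + 2) * m" using m0 by simp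
  moreover have "\<not> p dvd (3 * j + 2) * m"
    using r unfolding jm by (metis dvd_add_right_iff dvd_triv_left nat_dvd_not_less)
  ultimately have x: "0 < (3 * j + 2) * m" "\<not> p dvd (3 * j + 2) * m" .
  have dv: "((3 * j + 2) * m - 1) div p = j * Q + 2 * m1"
  proof -
    have "(3 * j + 2) * m - 1 = (2 * c - j - 1) + p * (j * Q + 2 * m1)" unfolding jm using r by simp
    moreover have "(2 * c - j - 1) div p = 0" using r by simp
    moreover have "p > 0" using pc by simp
    ultimately show ?thesis by (simp only: div_mult_self2)
  qed
  have "[(m - 1 choose (j * Q + 2 * m1)) = (c choose j) * (m1 - 1 choose (2 * m1))] (mod p)"
  proof -
    have "m - 1 = c * Q + (m1 - 1)" using Q(3) unfolding mQ by simp
    then show ?thesis using lucas_top_digit[OF p, of "m1 - 1" e "2 * m1" c j] Q by auto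
  qed
  then have "[(m - 1 choose (((3 * j + 2) * m - 1) div p)) * 1
      = (m - 1 choose (((3 * j + 2) * m - 1) div p)) * 0] (mod p)"
    unfolding dv using Q(3) by (simp add: binomial_eq_0)
  from choose_mult_prime_cong[OF p m0 x x(1) cong_refl this] show ?thesis by simp
qed

section \<open>Factorials without the multiples of a prime\<close>

definition coprime_fact :: "nat \<Rightarrow> nat \<Rightarrow> nat" where
  "coprime_fact p n = (\<Prod>a | 1 \<le> a \<and> a \<le> n \<and> coprime a p. a)"

lemma coprime_fact_0 [simp]: "coprime_fact p 0 = 1"
proof -
  have "{a. 1 \<le> a \<and> a \<le> 0 \<and> coprime a p} = {}" by auto
  then show ?thesis unfolding coprime_fact_def by (metis prod.empty)
qed

lemma coprime_fact_Suc:
  "coprime_fact p (Suc n) = (if coprime (Suc n) p then Suc n else 1) * coprime_fact p n"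
proof (cases "coprime (Suc n) p")
  case True
  have fin: "finite {a. 1 \<le> a \<and> a \<le> n \<and> coprime a p}" by simp
  have "{a. 1 \<le> a \<and> a \<le> Suc n \<and> coprime a p} = insert (Suc n) {a. 1 \<le> a \<and> a \<le> n \<and> coprime a p}"
    using True by (auto simp: le_Suc_eq)
  then show ?thesis unfolding coprime_fact_def using True fin by simp
next
  case False
  then have "{a. 1 \<le> a \<and> a \<le> Suc n \<and> coprime a p} = {a. 1 \<le> a \<and> a \<le> n \<and> coprime a p}"
    by (auto simp: le_Suc_eq)
  then show ?thesis unfolding coprime_fact_def using False by simp
qed

lemma coprime_coprime_fact: "coprime (coprime_fact p n) p"
  unfolding coprime_fact_def by (intro prod_coprime_left) auto

lemma fact_eq_coprime_fact:
  assumes p: "Factorial_Ring.prime (p::nat)"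
  shows "fact n = coprime_fact p n * p ^ (n div p) * fact (n div p)"
proof (induction n)
  case (Suc n)
  have iff: "coprime (Suc n) p \<longleftrightarrow> \<not> p dvd Suc n"
    using p by (metis coprime_commute prime_imp_coprime coprime_absorb_left not_prime_unit)
  show ?case
  proof (cases "p dvd Suc n")
    case True
    then have d: "Suc n div p = Suc (n div p)"
      by (simp add: div_Suc dvd_eq_mod_eq_0)
    have "Suc n = p * (Suc n div p)" using True by simp
    then have e: "Suc n = p * Suc (n div p)" unfolding d .
    have P: "coprime_fact p (Suc n) = coprime_fact p n" using True iff by (simp add: coprime_fact_Suc)
    have "(fact (Suc n) :: nat) = (p * Suc (n div p)) * (coprime_fact p n * p ^ (n div p) * fact (n div p))"
      unfolding fact_Suc Suc.IH of_nat_id by (subst e) (rule refl)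
    also have "\<dots> = coprime_fact p n * p ^ Suc (n div p) * fact (Suc (n div p))"
      unfolding fact_Suc power_Suc of_nat_id by (simp only: mult_ac)
    finally show ?thesis unfolding P d .
  next
    case False
    then have "Suc n div p = n div p" by (simp add: div_Suc dvd_eq_mod_eq_0)
    then show ?thesis using Suc False iff by (simp add: coprime_fact_Suc algebra_simps)
  qed
qed simp

text \<open>
  Doubling \<open>pk + c\<close> produces no carry out of the last digit because \<open>2c < p\<close>, so the multiples of
  \<open>p\<close> contribute exactly the central binomial coefficient of \<open>k\<close>.
\<close>
lemma central_choose_coprime_fact:
  assumes p: "Factorial_Ring.prime (p::nat)" and c: "2 * c < p"
  shows "(2 * (p * k + c) choose (p * k + c)) * coprime_fact p (p * k + c) ^ 2
       = coprime_fact p (2 * (p * k + c)) * (2 * k choose k)"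
proof -
  let ?M = "p * k + c"
  have p0: "p > 0" using c by simp
  have d: "?M div p = k" "2 * ?M div p = 2 * k"
  proof -
    have "?M = c + p * k" "2 * ?M = 2 * c + p * (2 * k)" by simp_all
    moreover have "(c + p * k) div p = k" "(2 * c + p * (2 * k)) div p = 2 * k"
      using c p0 by (simp_all only: div_mult_self2) simp_all
    ultimately show "?M div p = k" "2 * ?M div p = 2 * k" by metis+
  qed
  have "fact (2 * ?M) = fact ?M * fact ?M * (2 * ?M choose ?M)"
    using binomial_fact_lemma[of ?M "2 * ?M"] by (simp add: algebra_simps)
  moreover have "fact (2 * k) = fact k * fact k * (2 * k choose k)"
    using binomial_fact_lemma[of k "2 * k"] by (simp add: mult_ac)
  ultimately have "(coprime_fact p ?M * p ^ k * fact k)\<^sup>2 * (2 * ?M choose ?M)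
      = coprime_fact p (2 * ?M) * p ^ (2 * k) * (fact k * fact k * (2 * k choose k))"
    using fact_eq_coprime_fact[OF p, of ?M] fact_eq_coprime_fact[OF p, of "2 * ?M"] d
    by (simp add: power2_eq_square)
  moreover have "p ^ (2 * k) = p ^ k * p ^ k"
    by (simp add: mult_2 power_add)
  ultimately have "(p ^ k * fact k)\<^sup>2 * ((2 * ?M choose ?M) * coprime_fact p ?M ^ 2)
     = (p ^ k * fact k)\<^sup>2 * (coprime_fact p (2 * ?M) * (2 * k choose k))"
    unfolding power2_eq_square by (simp only: mult_ac)
  then show ?thesis using p0 by simp
qed

lemma coprime_fact_add_square:
  "[coprime_fact p (p\<^sup>2 + k) = coprime_fact p (p\<^sup>2) * coprime_fact p k] (mod p\<^sup>2)"
proof (induction k)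
  case (Suc k)
  have "coprime (Suc (p\<^sup>2 + k)) p \<longleftrightarrow> coprime (Suc k) p"
  proof -
    have "Suc (p\<^sup>2 + k) = Suc k + p * p" by (simp add: power2_eq_square)
    then show ?thesis by (metis gcd_add_mult coprime_iff_gcd_eq_1 gcd.commute mult.commute add.commute)
  qed
  moreover have "[Suc (p\<^sup>2 + k) = Suc k] (mod p\<^sup>2)"
    unfolding Cong.cong_def by (metis add_Suc_right mod_add_self1)
  ultimately have "[(if coprime (Suc (p\<^sup>2 + k)) p then Suc (p\<^sup>2 + k) else 1)
     = (if coprime (Suc k) p then Suc k else 1)] (mod p\<^sup>2)" by auto
  from cong_mult[OF this Suc.IH] show ?case
    by (simp add: coprime_fact_Suc mult_ac split del: if_split)
qed simp

text \<open>
  The factor \<open>p\<^sup>2 - a\<close> that leaves the first product is congruent to minus the factor \<open>a\<close> that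
  enters the second one. Squaring disposes of the sign.
\<close>
lemma coprime_fact_reflect:
  assumes "k < p\<^sup>2"
  shows "[(int (coprime_fact p (p\<^sup>2 - 1 - k)) * int (coprime_fact p k))\<^sup>2
     = (int (coprime_fact p (p\<^sup>2 - 1)))\<^sup>2] (mod (int p)\<^sup>2)"
  using assms
proof (induction k)
  case (Suc k)
  define r where "r = p\<^sup>2 - Suc k"
  have r: "p\<^sup>2 - 1 - k = r" "p\<^sup>2 - 1 - Suc k = r - 1" "Suc (r - 1) = r" "int r = (int p)\<^sup>2 - int (Suc k)"
    using Suc.prems by (auto simp: r_def of_nat_diff)
  have cop: "coprime r p \<longleftrightarrow> coprime (Suc k) p"
  proof -
    have "r + Suc k = p * p" using Suc.prems by (simp add: r_def power2_eq_square)
    moreover have "coprime x p" if "x + y = p * p" "coprime y p" for x y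
    proof (rule coprimeI)
      fix d assume d: "d dvd x" "d dvd p"
      then have "d dvd y" using that(1) by (metis dvd_add_right_iff dvd_mult2)
      then show "is_unit d" using that(2) d(2) coprime_common_divisor by blast
    qed
    ultimately show ?thesis by (metis add.commute)
  qed
  have sq: "[(int r)\<^sup>2 = (int (Suc k))\<^sup>2] (mod (int p)\<^sup>2)"
    unfolding r(4) cong_iff_dvd_diff by (simp add: power2_eq_square algebra_simps)
  define u v where "u = (if coprime (Suc k) p then int r else 1)"
    and "v = (if coprime (Suc k) p then int (Suc k) else 1)"
  have uv: "[v\<^sup>2 = u\<^sup>2] (mod (int p)\<^sup>2)"
    unfolding u_def v_def using cong_sym[OF sq] by auto
  have Pr: "int (coprime_fact p r) = u * int (coprime_fact p (r - 1))"
    using coprime_fact_Suc[of p "r - 1"] r(3) cop by (auto simp: u_def)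
  have Pk: "int (coprime_fact p (Suc k)) = v * int (coprime_fact p k)"
    using coprime_fact_Suc[of p k] by (auto simp: v_def)
  have "(int (coprime_fact p (p\<^sup>2 - 1 - Suc k)) * int (coprime_fact p (Suc k)))\<^sup>2
      = v\<^sup>2 * (int (coprime_fact p (r - 1)) * int (coprime_fact p k))\<^sup>2"
    unfolding r(2) Pk by (simp add: power_mult_distrib)
  also have "[v\<^sup>2 * (int (coprime_fact p (r - 1)) * int (coprime_fact p k))\<^sup>2
      = u\<^sup>2 * (int (coprime_fact p (r - 1)) * int (coprime_fact p k))\<^sup>2] (mod (int p)\<^sup>2)"
    by (intro cong_mult uv cong_refl)
  also have "u\<^sup>2 * (int (coprime_fact p (r - 1)) * int (coprime_fact p k))\<^sup>2
     = (int (coprime_fact p (p\<^sup>2 - 1 - k)) * int (coprime_fact p k))\<^sup>2"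
    unfolding r(1) Pr by (simp add: power_mult_distrib)
  also have "[\<dots> = (int (coprime_fact p (p\<^sup>2 - 1)))\<^sup>2] (mod (int p)\<^sup>2)"
    using Suc by auto
  finally show ?case .
qed simp

text \<open>
  A weak form of Wilson's theorem modulo \<open>p\<^sup>2\<close>: inversion permutes the units.
\<close>
lemma coprime_fact_square_squared:
  assumes p: "Factorial_Ring.prime (p::nat)"
  shows "[(coprime_fact p (p\<^sup>2))\<^sup>2 = 1] (mod p\<^sup>2)"
proof -
  define T where "T = {a. 1 \<le> a \<and> a \<le> p\<^sup>2 \<and> coprime a p}"
  define recip where "recip a = nat (modular_inverse (int p ^ 2) (int a))" for a
  have p2: "int p ^ 2 > 1" using prime_gt_1_nat[OF p] by simp
  have recip: "recip a \<in> T \<and> recip (recip a) = a \<and> [a * recip a = 1] (mod p\<^sup>2)" if "a \<in> T" for a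
  proof -
    have cop: "coprime (int a) (int p ^ 2)" using that by (simp add: T_def)
    have "\<not> coprime (p\<^sup>2) p" using prime_gt_1_nat[OF p] by (simp add: power2_eq_square)
    then have lt: "a < p\<^sup>2" using that by (auto simp: T_def order_less_le)
    let ?b = "modular_inverse (int p ^ 2) (int a)"
    have b: "0 < ?b" "?b < int p ^ 2" "coprime ?b (int p ^ 2)" "[int a * ?b = 1] (mod int p ^ 2)"
      using p2 mult_modular_inverse_int_pos[OF p2 cop] prime_gt_0_nat[OF p]
        modular_inverse_int_less[of "int p ^ 2" "int a"]
        coprime_modular_inverse[OF cop] cong_modular_inverse1[OF cop] by simp_all
    then have ib: "int (recip a) = ?b" by (simp add: recip_def)
    have "modular_inverse (int p ^ 2) ?b = int a"
      by (rule modular_inverse_int_eqI) (use b(4) lt in \<open>auto simp: mult.commute simp flip: of_nat_power\<close>)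
    then have "recip (recip a) = a" unfolding recip_def[of "recip a"] ib by simp
    moreover have "[a * recip a = 1] (mod p\<^sup>2)"
      using b(4) unfolding ib[symmetric] by (metis cong_int_iff of_nat_1 of_nat_mult of_nat_power)
    moreover have "recip a \<in> T"
      using b(1-3) unfolding ib[symmetric] T_def by (simp flip: of_nat_power)
    ultimately show ?thesis by blast
  qed
  have fact: "coprime_fact p (p\<^sup>2) = (\<Prod>a\<in>T. a)" by (simp add: coprime_fact_def T_def)
  also have "\<dots> = (\<Prod>a\<in>T. recip a)"
    by (rule prod.reindex_bij_witness[where i = recip and j = recip]) (use recip in auto)
  finally have "(coprime_fact p (p\<^sup>2))\<^sup>2 = (\<Prod>a\<in>T. a * recip a)"
    unfolding power2_eq_square[of "coprime_fact p (p\<^sup>2)"] prod.distrib using fact by simp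
  also have "[(\<Prod>a\<in>T. a * recip a) = (\<Prod>a\<in>T. 1)] (mod p\<^sup>2)"
    by (intro cong_prod) (use recip in auto)
  finally show ?thesis by simp
qed

lemma coprime_fact_index_cong:
  assumes p: "Factorial_Ring.prime (p::nat)" and l: "even l"
  shows "[coprime_fact p (p\<^sup>2 * l + k) = coprime_fact p k] (mod p\<^sup>2)"
proof -
  have step: "[coprime_fact p (p\<^sup>2 * (2 * h) + k) = coprime_fact p k] (mod p\<^sup>2)" for h
  proof (induction h)
    case (Suc h)
    let ?O = "coprime_fact p (p\<^sup>2)" and ?n = "p\<^sup>2 * (2 * h) + k"
    have "coprime_fact p (p\<^sup>2 * (2 * Suc h) + k) = coprime_fact p (p\<^sup>2 + (p\<^sup>2 + ?n))"
      by (simp add: algebra_simps)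
    also have "[coprime_fact p (p\<^sup>2 + (p\<^sup>2 + ?n)) = ?O * (?O * coprime_fact p ?n)] (mod p\<^sup>2)"
      by (rule cong_trans[OF coprime_fact_add_square]) (intro cong_mult cong_refl coprime_fact_add_square)
    also have "?O * (?O * coprime_fact p ?n) = ?O\<^sup>2 * coprime_fact p ?n" by (simp add: power2_eq_square)
    also have "[?O\<^sup>2 * coprime_fact p ?n = 1 * coprime_fact p k] (mod p\<^sup>2)"
      by (intro cong_mult coprime_fact_square_squared[OF p] Suc.IH)
    finally show ?case by simp
  qed simp
  then show ?thesis using l by (elim evenE) auto
qed

text \<open>
  For \<open>p \<equiv> 1 (mod 3)\<close>, the integer \<open>(p\<^sup>k - 1) / 3\<close>, all of whose \<open>k\<close> base-\<open>p\<close> digits are \<open>(p - 1) / 3\<close>.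
\<close>
fun third_trunc :: "nat \<Rightarrow> nat \<Rightarrow> nat" where
  "third_trunc p 0 = 0"
| "third_trunc p (Suc k) = p * third_trunc p k + (p - 1) div 3"

lemma third_trunc_eq:
  assumes "p = 3 * c + 1"
  shows "3 * third_trunc p k + 1 = p ^ k"
proof (induction k)
  case (Suc k)
  have "(p - 1) div 3 = c" using assms by simp
  then have "3 * third_trunc p (Suc k) + 1 = p * (3 * third_trunc p k) + (3 * c + 1)"
    by (simp only: third_trunc.simps) simp
  also have "\<dots> = p * (3 * third_trunc p k) + p" using assms by (simp only:)
  also have "\<dots> = p * (3 * third_trunc p k + 1)" by simp
  finally show ?case using Suc.IH by (simp only: power_Suc)
qed simp

lemma even_third_trunc: "even ((p - 1) div 3) \<Longrightarrow> even (third_trunc p k)"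
  by (induction k) auto

lemma third_trunc_add_2: "third_trunc p (k + 2) = p\<^sup>2 * third_trunc p k + third_trunc p 2"
proof -
  have "k + 2 = Suc (Suc k)" "(2::nat) = Suc (Suc 0)" by simp_all
  then show ?thesis
    by (simp only: third_trunc.simps power2_eq_square) (simp add: distrib_left)
qed

text \<open>
  Each further digit multiplies the central binomial coefficient of \<open>M\<close> by \<open>P(2M) / P(M)\<^sup>2\<close>, where
  \<open>P\<close> denotes the factorial without multiples of \<open>p\<close>. From two digits on, this ratio does not
  depend on the number of digits, so it equals \<open>P(N) P(2N) / P(N)\<^sup>3\<close>.
\<close>
lemma central_choose_third_trunc_cong:
  assumes p: "Factorial_Ring.prime (p::nat)" and pc: "p = 3 * c + 1" and c: "even c"
  defines "N \<equiv> third_trunc p 2"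
  shows "[(2 * third_trunc p (k + 1) choose (third_trunc p (k + 1))) * coprime_fact p N ^ (3 * k)
     = (coprime_fact p N * coprime_fact p (2 * N)) ^ k * (2 * c choose c)] (mod p\<^sup>2)"
proof (induction k)
  case 0
  show ?case using pc by simp
next
  case (Suc k)
  let ?P = "coprime_fact p" and ?M = "third_trunc p" and ?B = "\<lambda>k. 2 * third_trunc p k choose (third_trunc p k)"
  have M: "?M (Suc (k + 1)) = p * ?M (k + 1) + c" using pc by simp
  have M': "?M (Suc (k + 1)) = p\<^sup>2 * ?M k + N" unfolding N_def using third_trunc_add_2[of p k] by simp
  have ev: "even (?M k)" using even_third_trunc c pc by simp
  have N1: "[?P (?M (Suc (k + 1))) = ?P N] (mod p\<^sup>2)"
    unfolding M' using ev by (rule coprime_fact_index_cong[OF p])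
  have N2: "[?P (2 * ?M (Suc (k + 1))) = ?P (2 * N)] (mod p\<^sup>2)"
  proof -
    have "2 * ?M (Suc (k + 1)) = p\<^sup>2 * (2 * ?M k) + 2 * N" unfolding M' by simp
    then show ?thesis using coprime_fact_index_cong[OF p, of "2 * ?M k" "2 * N"] by simp
  qed
  have A: "?B (Suc (k + 1)) * ?P (?M (Suc (k + 1))) ^ 2 = ?P (2 * ?M (Suc (k + 1))) * ?B (k + 1)"
    unfolding M by (rule central_choose_coprime_fact[OF p]) (use pc in simp)
  have "3 * Suc k = 2 + (1 + 3 * k)" by simp
  then have "?B (Suc (k + 1)) * ?P N ^ (3 * Suc k) = (?B (Suc (k + 1)) * ?P N ^ 2) * (?P N * ?P N ^ (3 * k))"
    by (simp only: power_add power_one_right mult.assoc)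
  also have "[(?B (Suc (k + 1)) * ?P N ^ 2) * (?P N * ?P N ^ (3 * k))
      = (?B (Suc (k + 1)) * ?P (?M (Suc (k + 1))) ^ 2) * (?P N * ?P N ^ (3 * k))] (mod p\<^sup>2)"
    by (rule cong_mult[OF cong_mult[OF cong_refl cong_pow[OF cong_sym[OF N1]]] cong_refl])
  also have "(?B (Suc (k + 1)) * ?P (?M (Suc (k + 1))) ^ 2) * (?P N * ?P N ^ (3 * k))
      = ?P (2 * ?M (Suc (k + 1))) * ?P N * (?B (k + 1) * ?P N ^ (3 * k))"
    unfolding A by (simp only: mult_ac)
  also have "[?P (2 * ?M (Suc (k + 1))) * ?P N * (?B (k + 1) * ?P N ^ (3 * k))
      = ?P (2 * N) * ?P N * ((?P N * ?P (2 * N)) ^ k * (2 * c choose c))] (mod p\<^sup>2)"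
    by (rule cong_mult[OF cong_mult[OF N2 cong_refl] Suc.IH])
  finally show ?case by (simp only: mult_ac power_Suc add_Suc)
qed

lemma coprime_fact_third_mult:
  assumes p: "Factorial_Ring.prime (p::nat)" and pc: "p = 3 * c + 1"
  shows "[(coprime_fact p (third_trunc p 2) * coprime_fact p (2 * third_trunc p 2))\<^sup>2 = 1] (mod p\<^sup>2)"
proof -
  let ?N = "third_trunc p 2" and ?P = "coprime_fact p"
  have N: "3 * ?N + 1 = p\<^sup>2" by (rule third_trunc_eq[OF pc])
  have "p \<noteq> 1" using p by auto
  then have "\<not> coprime (p\<^sup>2) p" by (simp add: power2_eq_square)
  moreover have S: "p\<^sup>2 = Suc (3 * ?N)" "p\<^sup>2 - 1 = 3 * ?N" using N by simp_all
  ultimately have "?P (p\<^sup>2) = ?P (p\<^sup>2 - 1)"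
    using coprime_fact_Suc[of p "3 * ?N"] by (simp only: if_False mult_1)
  moreover have "p\<^sup>2 - 1 - ?N = 2 * ?N" "?N < p\<^sup>2" using S by linarith+
  ultimately have "[(int (?P (2 * ?N)) * int (?P ?N))\<^sup>2 = (int (?P (p\<^sup>2)))\<^sup>2] (mod (int p)\<^sup>2)"
    using coprime_fact_reflect[of ?N p] by (simp only:)
  then have "[(?P (2 * ?N) * ?P ?N)\<^sup>2 = (?P (p\<^sup>2))\<^sup>2] (mod p\<^sup>2)"
    by (metis cong_int_iff of_nat_mult of_nat_power)
  from cong_trans[OF this coprime_fact_square_squared[OF p]] show ?thesis
    by (simp only: mult.commute)
qed

section \<open>A polynomial model of the Witt vectors of length two\<close>

text \<open>
  Keeping the factor \<open>x\<close> in the error term shows that the error lies in any ideal containing \<open>x\<close>.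
\<close>
lemma add_power_prime:
  fixes x y :: "'a :: comm_ring_1"
  assumes p: "Factorial_Ring.prime (p::nat)"
  shows "\<exists>k. (x + y) ^ p = x ^ p + y ^ p + of_nat p * x * k"
proof -
  have p0: "p > 0" using prime_gt_0_nat[OF p] .
  define k where "k = (\<Sum>i\<in>{0<..<p}. of_nat ((p choose i) div p) * x ^ (i - 1) * y ^ (p - i))"
  have "(x + y) ^ p = (\<Sum>i\<le>p. of_nat (p choose i) * x ^ i * y ^ (p - i))"
    by (rule binomial_ring)
  also have "{..p} = insert 0 (insert p {0<..<p})" using p0 by auto
  also have "(\<Sum>i\<in>\<dots>. of_nat (p choose i) * x ^ i * y ^ (p - i))
     = y ^ p + (x ^ p + (\<Sum>i\<in>{0<..<p}. of_nat (p choose i) * x ^ i * y ^ (p - i)))"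
    using p0 by simp
  also have "(\<Sum>i\<in>{0<..<p}. of_nat (p choose i) * x ^ i * y ^ (p - i)) = of_nat p * x * k"
    unfolding k_def sum_distrib_left
  proof (rule sum.cong)
    fix i assume i: "i \<in> {0<..<p}"
    then have "p dvd (p choose i)" using p by (simp add: dvd_choose_prime)
    then have "(of_nat (p choose i) :: 'a) = of_nat p * of_nat ((p choose i) div p)"
      by (metis dvd_mult_div_cancel of_nat_mult)
    moreover have "x ^ i = x * x ^ (i - 1)" using i by (cases i) auto
    ultimately show "of_nat (p choose i) * x ^ i * y ^ (p - i)
      = of_nat p * x * (of_nat ((p choose i) div p) * x ^ (i - 1) * y ^ (p - i))"
      by (simp add: mult_ac)
  qed simp
  finally show ?thesis by (auto simp: algebra_simps)
qed

lemma prime_dvd_power_diff_int: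
  assumes p: "Factorial_Ring.prime (p::nat)"
  shows "int p dvd a ^ p - a"
proof -
  define n where "n = nat (a mod int p)"
  have p0: "p > 0" using prime_gt_0_nat[OF p] .
  have an: "[a = int n] (mod int p)" using p0 by (simp add: n_def Cong.cong_def)
  have "[n ^ p = n] (mod p)"
  proof (cases "p dvd n")
    case True
    then have "p dvd n ^ p" using p0 by (simp add: dvd_power_iff dvd_trans[of p n])
    then show ?thesis using True by (simp add: Cong.cong_def)
  next
    case False
    have "[n ^ (p - 1) * n = 1 * n] (mod p)"
      by (intro cong_mult fermat_theorem[OF p False] cong_refl)
    then show ?thesis using p0 by (simp add: power_eq_if[of n p] mult.commute)
  qed
  then have "[int n ^ p = int n] (mod int p)" by (metis cong_int_iff of_nat_power)
  with an have "[a ^ p = a] (mod int p)" by (meson cong_pow cong_sym cong_trans)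
  then show ?thesis by (simp add: cong_iff_dvd_diff)
qed

lemma pcompose_frobenius:
  fixes f :: "int poly"
  assumes p: "Factorial_Ring.prime (p::nat)"
  shows "\<exists>h. pcompose f (monom 1 p) = f ^ p + of_nat p * h"
proof (induction f)
  case 0
  then show ?case using prime_gt_0_nat[OF p] by (intro exI[of _ 0]) simp
next
  case (pCons a f)
  then obtain h where h: "pcompose f (monom 1 p) = f ^ p + of_nat p * h" by blast
  obtain t where t: "a ^ p = a + int p * t"
    using prime_dvd_power_diff_int[OF p, of a] by (metis dvdE diff_add_cancel add.commute)
  have X: "monom 1 1 ^ p = (monom 1 p :: int poly)" by (simp add: monom_power)
  have pC: "pCons a f = [:a:] + monom 1 1 * f" by (simp add: monom_altdef)
  obtain k where k: "([:a:] + monom 1 1 * f) ^ p = [:a:] ^ p + (monom 1 1 * f) ^ p + of_nat p * [:a:] * k"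
    using add_power_prime[OF p] by blast
  have "[:a:] ^ p = [:a:] + of_nat p * [:t:]"
    unfolding poly_const_pow t by (simp add: of_nat_poly)
  then have "pCons a f ^ p = [:a:] + of_nat p * [:t:] + monom 1 p * f ^ p + of_nat p * [:a:] * k"
    unfolding pC k by (simp only: power_mult_distrib X)
  then have "pcompose (pCons a f) (monom 1 p)
     = pCons a f ^ p + of_nat p * (monom 1 p * h - [:t:] - [:a:] * k)"
    unfolding pcompose_pCons h by (simp add: algebra_simps)
  then show ?case by blast
qed

locale poly_evaluation = Ring.field R for R (structure) +
  fixes p :: nat and g
  assumes p: "Factorial_Ring.prime p"
    and char: "add_pow R p \<one> = \<zero>"
    and g_closed: "g \<in> carrier R"
begin

definition emb :: "int \<Rightarrow> 'a" where
  "emb k = add_pow R k \<one>"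

lemma emb_closed [simp]: "emb k \<in> carrier R"
  unfolding emb_def by (rule add.int_pow_closed) simp

lemma emb_0 [simp]: "emb 0 = \<zero>"
  by (simp add: emb_def add_pow_int_ge)

lemma emb_1 [simp]: "emb 1 = \<one>"
  unfolding emb_def by (rule add.int_pow_1) simp

lemma emb_add: "emb (i + j) = emb i \<oplus> emb j"
  unfolding emb_def by (rule add.int_pow_mult) simp

lemma emb_mult: "emb (i * j) = emb i \<otimes> emb j"
proof -
  have "emb i \<otimes> emb j = add_pow R i (\<one> \<otimes> emb j)"
    unfolding emb_def by (rule add_pow_ldistr_int) (simp_all add: emb_def[symmetric])
  also have "\<dots> = add_pow R i (add_pow R j \<one>)" by (simp add: emb_def[symmetric])
  also have "\<dots> = add_pow R (j * i) \<one>" by (rule add.int_pow_pow) simp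
  finally show ?thesis by (simp add: emb_def mult.commute)
qed

lemma emb_p: "emb (int p) = \<zero>"
  using char by (simp add: emb_def add_pow_int_ge)

lemma emb_eq_0_iff: "emb k = \<zero> \<longleftrightarrow> int p dvd k"
proof
  assume "int p dvd k"
  then show "emb k = \<zero>" by (auto simp: emb_mult emb_p)
next
  assume k: "emb k = \<zero>"
  show "int p dvd k"
  proof (rule ccontr)
    assume "\<not> int p dvd k"
    then have "coprime (int p) k" using p by (simp add: prime_imp_coprime)
    then obtain a b where "a * int p + b * k = 1" by (metis coprime_iff_gcd_eq_1 bezout_int)
    then have "emb (a * int p + b * k) = \<one>" by simp
    then show False using k by (simp add: emb_add emb_mult emb_p)
  qed
qed

text \<open>
  Horner evaluation at \<open>g\<close>: the ring homomorphism from integer polynomials to the field that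
  sends \<open>X\<close> to \<open>g\<close>.
\<close>
definition ev :: "int poly \<Rightarrow> 'a" where
  "ev f = fold_coeffs (\<lambda>a y. emb a \<oplus> g \<otimes> y) f \<zero>"

lemma ev_0 [simp]: "ev 0 = \<zero>"
  by (simp add: ev_def)

lemma ev_pCons: "ev (pCons a f) = emb a \<oplus> g \<otimes> ev f"
  using g_closed by (cases "a = 0 \<and> f = 0") (auto simp: ev_def)

lemma ev_closed [simp]: "ev f \<in> carrier R"
  using g_closed by (induction f) (auto simp: ev_pCons)

lemma ev_add: "ev (f + h) = ev f \<oplus> ev h"
proof (induction f h rule: poly_induct2)
  case (pCons a f b h)
  then show ?case using g_closed by (simp add: ev_pCons emb_add r_distr a_ac)
qed simp

lemma ev_smult: "ev (smult a f) = emb a \<otimes> ev f"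
proof (induction f)
  case (pCons b f)
  then show ?case using g_closed by (simp add: ev_pCons emb_mult r_distr m_ac)
qed simp

lemma ev_mult: "ev (f * h) = ev f \<otimes> ev h"
proof (induction f)
  case (pCons a f)
  then show ?case using g_closed by (simp add: ev_pCons ev_add ev_smult l_distr m_assoc)
qed simp

lemma ev_const [simp]: "ev [:a:] = emb a"
  using g_closed by (simp add: ev_pCons)

lemma ev_1 [simp]: "ev 1 = \<one>"
  using ev_const[of 1] by (simp add: one_pCons)

lemma ev_of_int [simp]: "ev (of_int k) = emb k"
  by (simp add: of_int_poly)

lemma ev_of_nat [simp]: "ev (of_nat k) = emb (int k)"
  by (simp add: of_nat_poly)

lemma ev_power: "ev (f ^ k) = ev f [^] k"
  by (induction k) (simp_all add: ev_mult m_comm)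

lemma ev_uminus: "ev (- f) = \<ominus> ev f"
proof -
  have "ev (- f) \<oplus> ev f = \<zero>" using ev_add[of "- f" f] by simp
  then show ?thesis by (simp add: minus_equality)
qed

lemma ev_diff: "ev (f - h) = ev f \<ominus> ev h"
  using ev_add[of f "- h"] by (simp add: ev_uminus a_minus_def)

lemma ev_diff_eq_0_iff: "ev (f - h) = \<zero> \<longleftrightarrow> ev f = ev h"
  by (simp add: ev_diff)

lemma ev_X_power: "ev (monom 1 k) = g [^] k"
proof -
  have "ev (monom 1 1) = g" using g_closed by (simp add: ev_pCons monom_altdef)
  then show ?thesis using ev_power[of "monom 1 1" k] by (simp add: monom_power)
qed

text \<open>
  On the kernel \<open>I\<close> of \<open>ev\<close>, the map sending \<open>f\<close> to \<open>(f(X\<^sup>p) - f\<^sup>p) / p\<close> modulo \<open>I\<close> is additive,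
  takes \<open>f h\<close> to \<open>h(X\<^sup>p)\<close> times the value at \<open>f\<close>, kills \<open>I\<^sup>2\<close> and sends \<open>p\<close> to 1. Its kernel
  is therefore an ideal that contains \<open>I\<^sup>2\<close> and meets the integers only in the multiples of
  \<open>p\<^sup>2\<close>; the quotient by it plays the role of the Witt vectors of length two.
\<close>
definition witt_null :: "int poly \<Rightarrow> bool" where
  "witt_null f \<longleftrightarrow> ev f = \<zero> \<and> (\<exists>h. ev h = \<zero> \<and> pcompose f (monom 1 p) = f ^ p + of_nat p * h)"

lemma p_pos: "p > 0"
  using prime_gt_0_nat[OF p] .

lemma ev_power_eq_0: "ev f = \<zero> \<Longrightarrow> k > 0 \<Longrightarrow> ev (f ^ k) = \<zero>"
  by (cases k) (auto simp: ev_mult)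

lemma witt_null_0 [simp]: "witt_null 0"
  unfolding witt_null_def using p_pos by (auto intro!: exI[of _ 0])

lemma witt_null_add:
  assumes "witt_null f" "witt_null h"
  shows "witt_null (f + h)"
proof -
  obtain u v where u: "ev u = \<zero>" "pcompose f (monom 1 p) = f ^ p + of_nat p * u"
    and v: "ev v = \<zero>" "pcompose h (monom 1 p) = h ^ p + of_nat p * v"
    using assms unfolding witt_null_def by blast
  obtain k where k: "(f + h) ^ p = f ^ p + h ^ p + of_nat p * f * k"
    using add_power_prime[OF p] by blast
  have "pcompose (f + h) (monom 1 p) = (f + h) ^ p + of_nat p * (u + v - f * k)"
    unfolding pcompose_add u v k by (simp add: algebra_simps)
  moreover have "ev (u + v - f * k) = \<zero>" "ev (f + h) = \<zero>"
    using u v assms unfolding witt_null_def by (simp_all add: ev_diff ev_add ev_mult)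
  ultimately show ?thesis unfolding witt_null_def by blast
qed

lemma witt_null_mult:
  assumes "witt_null f"
  shows "witt_null (f * h)"
proof -
  obtain u where u: "ev u = \<zero>" "pcompose f (monom 1 p) = f ^ p + of_nat p * u"
    using assms unfolding witt_null_def by blast
  obtain v where v: "pcompose h (monom 1 p) = h ^ p + of_nat p * v"
    using pcompose_frobenius[OF p] by blast
  have f: "ev f = \<zero>" using assms by (simp add: witt_null_def)
  have "pcompose (f * h) (monom 1 p)
      = (f * h) ^ p + of_nat p * (f ^ p * v + u * pcompose h (monom 1 p))"
    unfolding pcompose_mult u v by (simp add: algebra_simps power_mult_distrib)
  moreover have "ev (f ^ p * v + u * pcompose h (monom 1 p)) = \<zero>" "ev (f * h) = \<zero>"
    using u f ev_power_eq_0[OF f p_pos] by (simp_all add: ev_add ev_mult)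
  ultimately show ?thesis unfolding witt_null_def by blast
qed

lemma witt_null_mult_right: "witt_null f \<Longrightarrow> witt_null (h * f)"
  using witt_null_mult by (simp add: mult.commute)

lemma witt_null_uminus: "witt_null f \<Longrightarrow> witt_null (- f)"
  using witt_null_mult[of f "-1"] by simp

lemma witt_null_kernel_mult:
  assumes "ev f = \<zero>" "ev h = \<zero>"
  shows "witt_null (f * h)"
proof -
  obtain u where u: "pcompose f (monom 1 p) = f ^ p + of_nat p * u"
    using pcompose_frobenius[OF p] by blast
  obtain v where v: "pcompose h (monom 1 p) = h ^ p + of_nat p * v"
    using pcompose_frobenius[OF p] by blast
  have "pcompose (f * h) (monom 1 p)
      = (f * h) ^ p + of_nat p * (f ^ p * v + u * h ^ p + of_nat p * (u * v))"
    unfolding pcompose_mult u v by (simp add: algebra_simps power_mult_distrib)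
  moreover have "ev (f ^ p * v + u * h ^ p + of_nat p * (u * v)) = \<zero>" "ev (f * h) = \<zero>"
    using assms ev_power_eq_0[OF _ p_pos] by (simp_all add: ev_add ev_mult emb_p)
  ultimately show ?thesis unfolding witt_null_def by blast
qed

lemma witt_null_of_int:
  assumes "witt_null (of_int N)"
  shows "(int p)\<^sup>2 dvd N"
proof -
  obtain h where h: "ev h = \<zero>" "pcompose (of_int N) (monom 1 p) = of_int N ^ p + of_nat p * h"
    using assms unfolding witt_null_def by blast
  have pN: "int p dvd N" using assms by (simp add: witt_null_def emb_eq_0_iff)
  have "[:N - N ^ p:] = of_nat p * h"
    using h(2) by (simp add: of_int_poly poly_const_pow pcompose_pCons)
       (metis add_diff_cancel_left' diff_pCons diff_self)
  then have hs: "smult (int p) h = [:N - N ^ p:]" by (simp add: of_nat_poly)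
  define t where "t = coeff h 0"
  have "h = [:t:]"
  proof (rule poly_eqI)
    fix i
    have "int p * coeff h i = coeff [:N - N ^ p:] i" using hs by (metis coeff_smult)
    then show "coeff h i = coeff [:t:] i"
      using p_pos by (cases i) (auto simp: t_def)
  qed
  with h(1) have "int p dvd t" by (simp add: emb_eq_0_iff)
  moreover have "N - N ^ p = int p * t" using hs \<open>h = [:t:]\<close> by simp
  ultimately have "(int p)\<^sup>2 dvd N - N ^ p" by (auto simp: power2_eq_square)
  moreover have "(int p)\<^sup>2 dvd N ^ p"
    using pN prime_ge_2_nat[OF p] by (meson dvd_power_same dvd_trans le_imp_power_dvd)
  ultimately show ?thesis by (metis diff_add_cancel dvd_add)
qed

definition witt_eq :: "int poly \<Rightarrow> int poly \<Rightarrow> bool" (infix "\<approx>" 50) where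
  "f \<approx> h \<longleftrightarrow> witt_null (f - h)"

lemma witt_eq_refl [simp]: "f \<approx> f"
  by (simp add: witt_eq_def)

lemma witt_eq_sym: "f \<approx> h \<Longrightarrow> h \<approx> f"
  unfolding witt_eq_def using witt_null_uminus by fastforce

lemma witt_eq_trans [trans]: "f \<approx> h \<Longrightarrow> h \<approx> k \<Longrightarrow> f \<approx> k"
  unfolding witt_eq_def using witt_null_add by fastforce

lemma witt_eq_add: "f \<approx> f' \<Longrightarrow> h \<approx> h' \<Longrightarrow> f + h \<approx> f' + h'"
  unfolding witt_eq_def using witt_null_add by (metis add_diff_add)

lemma witt_eq_mult:
  assumes "f \<approx> f'" "h \<approx> h'"
  shows "f * h \<approx> f' * h'"
proof -
  have "f * h - f' * h' = (f - f') * h + f' * (h - h')" by (simp add: algebra_simps)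
  then show ?thesis using assms unfolding witt_eq_def
    by (metis witt_null_add witt_null_mult witt_null_mult_right)
qed

lemma witt_eq_power: "f \<approx> h \<Longrightarrow> f ^ k \<approx> h ^ k"
  by (induction k) (auto intro: witt_eq_mult)

lemma witt_eq_sum: "(\<And>i. i \<in> A \<Longrightarrow> f i \<approx> h i) \<Longrightarrow> (\<Sum>i\<in>A. f i) \<approx> (\<Sum>i\<in>A. h i)"
  by (induction A rule: infinite_finite_induct) (auto intro: witt_eq_add)

lemma witt_eq_of_int_cong: "of_int a \<approx> of_int b \<Longrightarrow> [a = b] (mod (int p)\<^sup>2)"
  unfolding witt_eq_def cong_iff_dvd_diff using witt_null_of_int by (metis of_int_diff)

lemma witt_null_multiple: "p\<^sup>2 dvd n \<Longrightarrow> witt_null (of_nat n)"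
proof -
  assume "p\<^sup>2 dvd n"
  then obtain k where k: "n = p * p * k" by (auto simp: power2_eq_square)
  have "witt_null (of_nat p * of_nat p)" by (rule witt_null_kernel_mult) (simp_all add: emb_p)
  then show ?thesis using witt_null_mult[of "of_nat p * of_nat p" "of_nat k"] k by simp
qed

text \<open>
  The principle behind Teichmueller lifts: in \<open>f\<^sup>p - h\<^sup>p\<close> both the factor \<open>f - h\<close> and the
  cofactor, which is \<open>p f\<^bsup>p - 1\<^esup>\<close> modulo \<open>I\<close>, lie in \<open>I\<close>.
\<close>
lemma ev_eq_imp_power_witt_eq:
  assumes "ev f = ev h"
  shows "f ^ p \<approx> h ^ p"
proof -
  have "f ^ p - h ^ p = (f - h) * (\<Sum>i<p. f ^ (p - Suc i) * h ^ i)"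
    using power_diff_sumr2[of h p f] by (simp add: algebra_simps)
  moreover have "ev (\<Sum>i<p. f ^ (p - Suc i) * h ^ i) = \<zero>"
  proof -
    have "ev (\<Sum>i<n. f ^ (p - Suc i) * h ^ i) = emb (int n) \<otimes> ev (f ^ (p - 1))" if "n \<le> p" for n
      using that
    proof (induction n)
      case (Suc n)
      have "ev (f ^ (p - Suc n) * h ^ n) = ev f [^] (p - Suc n) \<otimes> ev f [^] n"
        using assms by (simp add: ev_mult ev_power)
      also have "\<dots> = ev (f ^ (p - 1))"
        using Suc.prems by (simp add: nat_pow_mult ev_power)
      finally show ?case using Suc by (simp add: ev_add emb_add l_distr a_comm)
    qed simp
    from this[of p] show ?thesis by (simp add: emb_p)
  qed
  ultimately show ?thesis unfolding witt_eq_def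
    using witt_null_kernel_mult[of "f - h"] assms by (simp add: ev_diff_eq_0_iff)
qed

end

section \<open>Counting points over a finite field modulo the square of its characteristic\<close>

text \<open>
  With \<open>g\<close> a generator of the multiplicative group, the nontrivial cubic characters are the
  \<open>m\<close>-th and \<open>2m\<close>-th powers.
\<close>
locale finite_field_evaluation = poly_evaluation R p g for R (structure) and p g +
  fixes q m :: nat
  assumes card_R: "card (carrier R) = q"
    and p_odd: "odd p"
    and q_div: "p\<^sup>2 dvd q"
    and q_m: "q = 3 * m + 1" and m_pos: "m > 0"
    and gen: "bij_betw (\<lambda>k::nat. g [^] k) {..<q - 1} (carrier R - {\<zero>})"
    and g_pow: "g [^] k = \<one> \<longleftrightarrow> (q - 1) dvd (k::nat)"
begin

lemma finite_R: "finite (carrier R)"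
  using card_R q_m by (metis card.infinite add_is_0 zero_neq_one)

lemma p_ge_2: "p \<ge> 2"
  using prime_ge_2_nat[OF p] .

lemma g_pow_closed [simp]: "g [^] (k::nat) \<in> carrier R"
  using g_closed by simp

lemma g_nonzero: "g [^] (k::nat) \<noteq> \<zero>"
proof
  assume *: "g [^] k = \<zero>"
  have "g [^] (k * (q - 1)) = \<one>" by (simp add: g_pow)
  moreover have "g [^] (k * (q - 1)) = (g [^] k) [^] (q - 1)"
    using g_closed by (simp add: nat_pow_pow)
  ultimately show False using * q_m m_pos by (simp add: nat_pow_zero)
qed

lemma g_pow_cong: "g [^] (i::nat) = g [^] (j::nat) \<longleftrightarrow> [i = j] (mod (q - 1))"
proof -
  have *: "g [^] i = g [^] j \<longleftrightarrow> [i = j] (mod (q - 1))" if "i \<le> j" for i j :: nat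
  proof -
    have "g [^] j = g [^] i \<otimes> g [^] (j - i)"
      using g_closed that by (simp add: nat_pow_mult)
    then have "g [^] i = g [^] j \<longleftrightarrow> g [^] i \<otimes> \<one> = g [^] i \<otimes> g [^] (j - i)"
      by simp
    also have "\<dots> \<longleftrightarrow> \<one> = g [^] (j - i)"
      using g_nonzero by (subst m_lcancel) auto
    also have "\<dots> \<longleftrightarrow> (q - 1) dvd j - i" using g_pow[of "j - i"] by auto
    also have "\<dots> \<longleftrightarrow> [j = i] (mod (q - 1))" using that by (metis cong_altdef_nat)
    finally show ?thesis by (simp add: cong_sym_eq)
  qed
  show ?thesis using *[of i j] *[of j i] by (cases "i \<le> j") (auto simp: cong_sym_eq)
qed

lemma nonzero_cases:
  assumes "v \<in> carrier R" "v \<noteq> \<zero>"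
  obtains k :: nat where "k < q - 1" "v = g [^] k"
  using gen assms unfolding bij_betw_def by blast

lemma pow_order: "v \<in> carrier R \<Longrightarrow> v \<noteq> \<zero> \<Longrightarrow> v [^] (q - 1) = \<one>"
  by (elim nonzero_cases) (use g_closed in \<open>simp_all add: nat_pow_pow g_pow\<close>)

text \<open>
  The ideal is primary to the maximal ideal \<open>I\<close>: with \<open>f\<^bsup>q - 2\<^esup>\<close> an inverse of \<open>f\<close> up to an error
  \<open>e\<close> in \<open>I\<close>, the square of \<open>e\<close> vanishes.
\<close>
lemma witt_null_cancel:
  assumes "ev f \<noteq> \<zero>" "witt_null (f * h)"
  shows "witt_null h"
proof -
  define e where "e = 1 - f ^ (q - 1)"
  have "ev e = \<zero>"
    unfolding e_def ev_diff_eq_0_iff using assms pow_order by (simp add: ev_power)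
  then have "witt_null (e * e * h)" by (intro witt_null_mult witt_null_kernel_mult)
  moreover have "h = e * e * h + f * h * (f ^ (q - 2) * (2 - f ^ (q - 1)))"
  proof -
    have "f * f ^ (q - 2) = f ^ (q - 1)" using q_m m_pos
      by (metis Suc_1 Suc_diff_Suc diff_Suc_1 power_Suc less_add_same_cancel2 One_nat_def
           add_Suc_right add_0_right Suc_less_eq mult_pos_pos zero_less_numeral)
    then have "f * h * (f ^ (q - 2) * (2 - f ^ (q - 1))) = f ^ (q - 1) * (2 - f ^ (q - 1)) * h"
      by (metis (no_types, lifting) mult.assoc mult.commute)
    then show ?thesis unfolding e_def by (simp add: algebra_simps)
  qed
  ultimately show ?thesis using assms(2) witt_null_add witt_null_mult by metis
qed

text \<open>
  The Teichmueller lift of \<open>g\<close>: being a \<open>p\<close>-th power, it satisfies \<open>Y\<^bsup>q - 1\<^esup> = 1\<close> in the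
  quotient, which \<open>X\<close> itself does only modulo \<open>I\<close>.
\<close>
definition Y :: "int poly" where
  "Y = monom 1 q"

lemma ev_Y_power: "ev (Y ^ k) = g [^] k"
proof -
  have "ev (Y ^ k) = g [^] (q * k)" using g_closed by (simp add: Y_def ev_power ev_X_power nat_pow_pow)
  also have "\<dots> = g [^] k"
    unfolding g_pow_cong using q_m by (simp add: Cong.cong_def)
  finally show ?thesis .
qed

lemma Y_power_order: "Y ^ (q - 1) \<approx> 1"
proof -
  have "p dvd q" using q_div by (meson dvd_trans dvd_power zero_less_numeral)
  then have "Y = monom 1 (q div p) ^ p" by (simp add: Y_def monom_power)
  then have "Y ^ (q - 1) = (monom 1 (q div p) ^ (q - 1)) ^ p" by (simp add: power_mult[symmetric] mult.commute)
  also have "\<dots> \<approx> 1 ^ p"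
    by (rule ev_eq_imp_power_witt_eq) (use g_closed in \<open>simp add: ev_power ev_X_power nat_pow_pow g_pow\<close>)
  finally show ?thesis by simp
qed

lemma Y_power_sum: "(\<Sum>k<q - 1. (Y ^ e) ^ k) \<approx> (if (q - 1) dvd e then -1 else 0)"
proof (cases "(q - 1) dvd e")
  case True
  then obtain t where t: "e = (q - 1) * t" by blast
  have 1: "(Y ^ e) ^ k \<approx> 1" for k
  proof -
    have "(Y ^ e) ^ k = (Y ^ (q - 1)) ^ (t * k)" by (simp add: t power_mult)
    also have "\<dots> \<approx> 1 ^ (t * k)" by (intro witt_eq_power Y_power_order)
    finally show ?thesis by simp
  qed
  have "(\<Sum>k<q - 1. (Y ^ e) ^ k) \<approx> (\<Sum>k<q - 1. 1)" by (intro witt_eq_sum 1)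
  also have "(\<Sum>k<q - 1. 1) = (of_nat q - 1 :: int poly)" using q_m by simp
  also have "of_nat q - 1 \<approx> -1"
    unfolding witt_eq_def using witt_null_multiple[OF q_div] by simp
  finally show ?thesis using True by simp
next
  case False
  have "(Y ^ e - 1) * (\<Sum>k<q - 1. (Y ^ e) ^ k) = (Y ^ (q - 1)) ^ e - 1"
    using power_diff_1_eq[of "Y ^ e" "q - 1"] power_commutes by (simp add: power_mult[symmetric] mult.commute)
  moreover have "(Y ^ (q - 1)) ^ e \<approx> 1 ^ e" by (intro witt_eq_power Y_power_order)
  ultimately have "witt_null ((Y ^ e - 1) * (\<Sum>k<q - 1. (Y ^ e) ^ k))" by (simp add: witt_eq_def)
  moreover have "ev (Y ^ e - 1) \<noteq> \<zero>"
    using False by (simp only: ev_diff_eq_0_iff ev_Y_power ev_1 g_pow) simp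
  ultimately have "witt_null (\<Sum>k<q - 1. (Y ^ e) ^ k)" by (rule witt_null_cancel[rotated])
  then show ?thesis using False by (simp add: witt_eq_def)
qed

definition cube_roots :: "'a \<Rightarrow> 'a set" where
  "cube_roots v = {x \<in> carrier R. x [^] (3::nat) = v}"

lemma card_cube_roots_power:
  "card (cube_roots (g [^] (k::nat))) = (if 3 dvd k then 3 else 0)"
proof (cases "3 dvd k")
  case True
  then obtain r where r: "k = 3 * r" by blast
  have m3: "q - 1 = 3 * m" using q_m by simp
  have iff: "(g [^] i) [^] (3::nat) = g [^] k \<longleftrightarrow> [i = r] (mod m)" for i :: nat
  proof -
    have "(g [^] i) [^] (3::nat) = g [^] (3 * i)" using g_closed by (simp add: nat_pow_pow mult.commute)
    then have "(g [^] i) [^] (3::nat) = g [^] k \<longleftrightarrow> [3 * i = 3 * r] (mod (3 * m))"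
      unfolding r by (simp only: g_pow_cong m3)
    also have "\<dots> \<longleftrightarrow> [i = r] (mod m)"
      by (simp add: Cong.cong_def mult_mod_right[symmetric])
    finally show ?thesis .
  qed
  have "cube_roots (g [^] k) = (\<lambda>j. g [^] (r mod m + j * m)) ` {..<3}"
  proof (intro equalityI subsetI)
    fix x assume x: "x \<in> cube_roots (g [^] k)"
    then have "x \<noteq> \<zero>" using g_nonzero[of k] by (auto simp: cube_roots_def nat_pow_zero)
    then obtain i :: nat where i: "i < q - 1" "x = g [^] i" using x nonzero_cases by (auto simp: cube_roots_def)
    then have "i mod m = r mod m" using x iff[of i] by (auto simp: cube_roots_def Cong.cong_def)
    then have eq: "r mod m + (i div m) * m = i" by (metis add.commute div_mult_mod_eq)
    have "x = g [^] (r mod m + (i div m) * m)" unfolding eq by (rule i(2))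
    moreover have "i div m < 3" using i(1) m3 by (simp add: less_mult_imp_div_less)
    ultimately show "x \<in> (\<lambda>j. g [^] (r mod m + j * m)) ` {..<3}" by blast
  next
    fix x assume "x \<in> (\<lambda>j. g [^] (r mod m + j * m)) ` {..<3}"
    then obtain j where "x = g [^] (r mod m + j * m)" by blast
    moreover have "[r mod m + j * m = r] (mod m)" by (simp add: Cong.cong_def)
    ultimately show "x \<in> cube_roots (g [^] k)" using iff by (simp add: cube_roots_def)
  qed
  moreover have "inj_on (\<lambda>j. g [^] (r mod m + j * m)) {..<3}"
  proof (rule inj_onI)
    fix i j :: nat assume ij: "i \<in> {..<3}" "j \<in> {..<3}"
      and "g [^] (r mod m + i * m) = g [^] (r mod m + j * m)"
    then have "[i * m = j * m] (mod (3 * m))" by (simp only: g_pow_cong m3 cong_add_lcancel_nat)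
    then have "i * m mod (3 * m) = j * m mod (3 * m)" by (simp add: Cong.cong_def)
    moreover have "i * m < 3 * m" "j * m < 3 * m" using ij m_pos by auto
    ultimately show "i = j" using m_pos by simp
  qed
  ultimately show ?thesis using True by (simp add: card_image)
next
  case False
  have "cube_roots (g [^] k) = {}"
  proof (rule ccontr)
    assume "cube_roots (g [^] k) \<noteq> {}"
    then obtain x where x: "x \<in> carrier R" "x [^] (3::nat) = g [^] k" by (auto simp: cube_roots_def)
    then have "x \<noteq> \<zero>" using g_nonzero[of k] by (auto simp: nat_pow_zero)
    then obtain i :: nat where "x = g [^] i" using x nonzero_cases by metis
    then have "g [^] (3 * i) = g [^] k" using x g_closed by (simp add: nat_pow_pow mult.commute)
    then have "[3 * i = k] (mod (3 * m))" using q_m by (simp add: g_pow_cong)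
    then have "3 dvd k" by (metis cong_dvd_iff cong_modulus_mult_nat dvd_triv_left)
    then show False using False by simp
  qed
  then show ?thesis using False by simp
qed

lemma card_cube_roots_0: "card (cube_roots \<zero>) = 1"
proof -
  have "cube_roots \<zero> = {\<zero>}"
    unfolding cube_roots_def by (auto simp: numeral_3_eq_3 integral_iff)
  then show ?thesis by simp
qed

text \<open>
  The right-hand side is the sum of the three cubic characters at \<open>v\<close>, realised by powers of the
  Teichmueller lift \<open>V\<^sup>p\<close> of \<open>v\<^sup>p\<close>, which is a cube exactly when \<open>v\<close> is. If \<open>v\<close> is not a cube, then \<open>V\<^bsup>pm\<^esup>\<close> is a root of \<open>X\<^sup>3 - 1\<close> different
  from 1 modulo \<open>I\<close>, hence a root of \<open>1 + X + X\<^sup>2\<close>.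
\<close>
lemma card_cube_roots_witt_eq:
  assumes V: "ev V = v" and v: "v \<in> carrier R"
  shows "of_nat (card (cube_roots v)) \<approx> 1 + V ^ (p * m) + V ^ (2 * p * m)"
proof (cases "v = \<zero>")
  case True
  have "V ^ p \<approx> 0 ^ p" by (rule ev_eq_imp_power_witt_eq) (simp add: V True)
  then have "witt_null (V ^ p)" using p_pos by (simp add: witt_eq_def zero_power)
  moreover have "V ^ (p * m) = V ^ p * V ^ (p * m - p)" "V ^ (2 * p * m) = V ^ p * V ^ (2 * p * m - p)"
    using m_pos by (simp_all add: power_add[symmetric])
  ultimately have "witt_null (V ^ (p * m) + V ^ (2 * p * m))"
    by (metis witt_null_add witt_null_mult)
  then have "witt_null (- (V ^ (p * m) + V ^ (2 * p * m)))" by (rule witt_null_uminus)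
  then show ?thesis unfolding witt_eq_def True card_cube_roots_0 by (simp add: algebra_simps)
next
  case False
  then obtain k :: nat where k: "v = g [^] k" using v nonzero_cases by blast
  define W where "W = V ^ m"
  have W: "ev W = g [^] (k * m)" using g_closed by (simp add: W_def ev_power V k nat_pow_pow)
  have VW: "V ^ (p * m) = W ^ p" "V ^ (2 * p * m) = (W ^ p) ^ 2"
    by (simp_all add: W_def power_mult[symmetric] mult_ac)
  have m3: "q - 1 = 3 * m" using q_m by simp
  show ?thesis
  proof (cases "3 dvd k")
    case True
    then have "ev W = ev 1" unfolding W ev_1 g_pow m3 by auto
    then have "W ^ p \<approx> 1 ^ p" by (rule ev_eq_imp_power_witt_eq)
    then have "W ^ p \<approx> 1" by simp
    then have "1 + W ^ p + (W ^ p) ^ 2 \<approx> 1 + 1 + 1 ^ 2"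
      by (intro witt_eq_add witt_eq_power witt_eq_refl)
    then have "1 + 1 + 1 ^ 2 \<approx> 1 + W ^ p + (W ^ p) ^ 2" by (rule witt_eq_sym)
    then show ?thesis using True unfolding VW k card_cube_roots_power by simp
  next
    case False
    have "ev (W ^ 3) = ev 1"
    proof -
      have "ev (W ^ 3) = g [^] (k * m * 3)" using W g_closed by (simp add: ev_power nat_pow_pow)
      also have "\<dots> = \<one>" unfolding g_pow m3 by simp
      finally show ?thesis by simp
    qed
    then have "(W ^ 3) ^ p \<approx> 1 ^ p" by (rule ev_eq_imp_power_witt_eq)
    moreover have "(W ^ p - 1) * (1 + W ^ p + (W ^ p) ^ 2) = (W ^ 3) ^ p - 1"
    proof -
      have "(W ^ 3) ^ p = (W ^ p) ^ 3" by (simp add: power_mult[symmetric] mult.commute)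
      then show ?thesis by (simp add: algebra_simps power2_eq_square power3_eq_cube)
    qed
    ultimately have "witt_null ((W ^ p - 1) * (1 + W ^ p + (W ^ p) ^ 2))"
      by (simp add: witt_eq_def)
    moreover have "ev (W ^ p - 1) \<noteq> \<zero>"
    proof
      assume "ev (W ^ p - 1) = \<zero>"
      then have "g [^] (k * m * p) = \<one>"
        using W g_closed by (simp add: ev_diff_eq_0_iff ev_power nat_pow_pow)
      then have "3 * m dvd (k * p) * m" unfolding g_pow m3 by (simp only: mult_ac)
      then have "3 dvd k * p" using m_pos by simp
      moreover have "\<not> 3 dvd p"
      proof
        assume "3 dvd p"
        then have "3 dvd q" using q_div by (meson dvd_trans dvd_power zero_less_numeral)
        then show False using q_m by presburger
      qed
      moreover have "Factorial_Ring.prime (3::nat)" by simp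
      ultimately show False using False prime_dvd_mult_iff by blast
    qed
    ultimately have "witt_null (1 + W ^ p + (W ^ p) ^ 2)" by (rule witt_null_cancel[rotated])
    then have "1 + W ^ p + (W ^ p) ^ 2 \<approx> 0" by (simp add: witt_eq_def)
    then have "0 \<approx> 1 + W ^ p + (W ^ p) ^ 2" by (rule witt_eq_sym)
    then show ?thesis using False unfolding VW k card_cube_roots_power by simp
  qed
qed


lemma ev_surj: "v \<in> carrier R \<Longrightarrow> \<exists>V. ev V = v"
  by (metis ev_0 ev_Y_power nonzero_cases)

lemma cube_roots_finite: "finite (cube_roots v)"
  using finite_R by (simp add: cube_roots_def)

lemma exists_sqrt_minus_one:
  assumes "4 dvd q - 1"
  shows "\<exists>J. ev (J * J + 1) = \<zero> \<and> ev J \<noteq> \<zero>"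
proof -
  obtain n where n: "q - 1 = 4 * n" using assms by blast
  have n0: "n > 0" using n q_m m_pos by (cases n) auto
  define J where "J = Y ^ n"
  have "ev ((J * J - 1) * (J * J + 1)) = \<zero>"
  proof -
    have "(J * J - 1) * (J * J + 1) = J ^ 4 - 1"
      by (simp add: algebra_simps power4_eq_xxxx)
    also have "J ^ 4 = Y ^ (4 * n)" by (simp add: J_def power_mult[symmetric] mult.commute)
    finally have "(J * J - 1) * (J * J + 1) = Y ^ (4 * n) - 1" .
    moreover have "ev (Y ^ (4 * n)) = ev 1" unfolding ev_Y_power ev_1 g_pow n by (rule dvd_refl)
    ultimately show ?thesis by (simp only: ev_diff_eq_0_iff)
  qed
  moreover have "ev (J * J - 1) \<noteq> \<zero>"
  proof -
    have "J * J = Y ^ (n + n)" by (simp add: J_def power_add)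
    then have "ev (J * J) \<noteq> ev 1" 
      using n0 by (simp only: ev_Y_power ev_1 g_pow n) (auto dest: dvd_imp_le)
    then show ?thesis by (simp only: ev_diff_eq_0_iff not_False_eq_True)
  qed
  ultimately have "ev (J * J + 1) = \<zero>" by (simp add: ev_mult integral_iff)
  moreover have "ev J \<noteq> \<zero>" unfolding J_def ev_Y_power by (rule g_nonzero)
  ultimately show ?thesis by blast
qed

lemma card_weierstrass_points_eq_sum:
  "card (weierstrass_points R \<zero> (\<ominus> \<one>)) = 1 + (\<Sum>y\<in>carrier R. card (cube_roots (y \<otimes> y \<oplus> \<one>)))"
proof -
  have iff: "y [^] (2::nat) = x [^] (3::nat) \<oplus> \<zero> \<otimes> x \<oplus> \<ominus> \<one> \<longleftrightarrow> x [^] (3::nat) = y \<otimes> y \<oplus> \<one>"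
    if xy: "x \<in> carrier R" "y \<in> carrier R" for x y
  proof -
    have key: "a = b \<ominus> \<one> \<longleftrightarrow> b = a \<oplus> \<one>" if "a \<in> carrier R" "b \<in> carrier R" for a b
      using that by (metis a_minus_def add.inv_closed add.inv_solve_right' add.m_comm one_closed
          add.inv_solve_right)
    have "y [^] (2::nat) = y \<otimes> y" using xy by (simp add: numeral_2_eq_2)
    moreover have "x [^] (3::nat) \<oplus> \<zero> \<otimes> x \<oplus> \<ominus> \<one> = x [^] (3::nat) \<ominus> \<one>" using xy by (simp add: a_minus_def)
    ultimately show ?thesis using key[of "y \<otimes> y" "x [^] (3::nat)"] xy by (simp only: m_closed nat_pow_closed)
  qed
  have "weierstrass_points R \<zero> (\<ominus> \<one>) = insert None
     {Some (x, y) | x y. x \<in> carrier R \<and> y \<in> carrier R \<and> x [^] (3::nat) = y \<otimes> y \<oplus> \<one>}"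
    unfolding weierstrass_points_def by (intro arg_cong[where f = "insert None"] Collect_cong) (metis iff)
  also have "\<dots> = insert None ((\<lambda>(y, x). Some (x, y)) ` (SIGMA y:carrier R. cube_roots (y \<otimes> y \<oplus> \<one>)))"
    by (auto simp: cube_roots_def image_iff)
  also have "card \<dots> = 1 + card ((\<lambda>(y, x). Some (x, y)) ` (SIGMA y:carrier R. cube_roots (y \<otimes> y \<oplus> \<one>)))"
    using finite_R cube_roots_finite by (subst card_insert_disjoint) auto
  also have "card ((\<lambda>(y, x). Some (x, y)) ` (SIGMA y:carrier R. cube_roots (y \<otimes> y \<oplus> \<one>)))
      = card (SIGMA y:carrier R. cube_roots (y \<otimes> y \<oplus> \<one>))"
    by (rule card_image) (auto simp: inj_on_def)
  also have "\<dots> = (\<Sum>y\<in>carrier R. card (cube_roots (y \<otimes> y \<oplus> \<one>)))"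
    using finite_R cube_roots_finite by (simp add: card_SigmaI)
  finally show ?thesis .
qed

text \<open>
  With \<open>J\<close> lifting a square root of \<open>-1\<close>, the substitution \<open>y = J (2 z - 1)\<close> turns \<open>y\<^sup>2 + 1\<close> into
  \<open>4 z (1 - z)\<close>, so that the point count becomes a sum of cubic characters of \<open>z (1 - z)\<close>.
\<close>
lemma sum_cube_roots_substitution:
  assumes four: "4 dvd q - 1"
  shows "(\<Sum>y\<in>carrier R. card (cube_roots (y \<otimes> y \<oplus> \<one>)))
       = (\<Sum>z\<in>carrier R. card (cube_roots (emb 4 \<otimes> z \<otimes> (\<one> \<ominus> z))))"
proof -
  obtain J where J: "ev (J * J + 1) = \<zero>" "ev J \<noteq> \<zero>"
    using exists_sqrt_minus_one[OF four] by blast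
  define h where "h z = ev J \<otimes> (emb 2 \<otimes> z \<ominus> \<one>)" for z
  have h: "h z = ev (J * (2 * Z - 1))" if "ev Z = z" for z Z
    using that ev_of_int[of 2] by (simp add: h_def ev_mult ev_diff)
  have "\<not> int p dvd 2"
  proof
    assume "int p dvd 2"
    then have "p dvd 2" by (metis int_dvd_int_iff of_nat_numeral)
    then show False using p_ge_2 p_odd by (metis dvd_imp_le le_antisym dvd_refl zero_less_numeral)
  qed
  then have two: "emb 2 \<noteq> \<zero>" by (simp add: emb_eq_0_iff)
  have inj: "inj_on h (carrier R)"
  proof (rule inj_onI)
    fix z z' assume zz: "z \<in> carrier R" "z' \<in> carrier R" "h z = h z'"
    obtain Z Z' where Z: "ev Z = z" "ev Z' = z'" using zz ev_surj by metis
    have "ev (J * (2 * Z - 1) - J * (2 * Z' - 1)) = \<zero>"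
      using zz h Z by (simp add: ev_diff_eq_0_iff)
    moreover have "J * (2 * Z - 1) - J * (2 * Z' - 1) = J * (of_int 2 * (Z - Z'))"
      by (simp add: algebra_simps)
    ultimately have "ev J \<otimes> (emb 2 \<otimes> ev (Z - Z')) = \<zero>" by (simp only: ev_mult ev_of_int)
    then have "ev (Z - Z') = \<zero>" using J(2) two by (simp add: integral_iff)
    then show "z = z'" using Z by (simp add: ev_diff_eq_0_iff)
  qed
  moreover have "h ` carrier R \<subseteq> carrier R" unfolding h_def by auto
  ultimately have bij: "bij_betw h (carrier R) (carrier R)"
    using finite_R by (simp add: bij_betw_def endo_inj_surj)
  have "h z \<otimes> h z \<oplus> \<one> = emb 4 \<otimes> z \<otimes> (\<one> \<ominus> z)" if z: "z \<in> carrier R" for z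
  proof -
    obtain Z where Z: "ev Z = z" using z ev_surj by blast
    have "h z \<otimes> h z \<oplus> \<one> = ev (J * (2 * Z - 1) * (J * (2 * Z - 1)) + 1)"
      using h[OF Z] by (simp add: ev_mult ev_add)
    also have "J * (2 * Z - 1) * (J * (2 * Z - 1)) + 1
       = (J * J + 1) * (2 * Z - 1)\<^sup>2 + of_int 4 * Z * (1 - Z)"
      by (simp add: algebra_simps power2_eq_square)
    also have "ev \<dots> = ev (of_int 4 * Z * (1 - Z))"
      using J(1) by (simp only: ev_add[of "(J * J + 1) * (2 * Z - 1)\<^sup>2"] ev_mult[of "J * J + 1"]) simp
    also have "\<dots> = emb 4 \<otimes> z \<otimes> (\<one> \<ominus> z)"
      by (simp only: ev_mult ev_of_int ev_diff ev_1 Z)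
    finally show ?thesis .
  qed
  then show ?thesis
    unfolding sum.reindex_bij_betw[OF bij, of "\<lambda>y. card (cube_roots (y \<otimes> y \<oplus> \<one>))", symmetric]
    by simp
qed

text \<open>
  The Jacobi sum expanded by the binomial theorem: only the powers of the Teichmueller lift that
  are multiples of \<open>q - 1\<close> survive summation over the multiplicative group.
\<close>
lemma jacobi_sum_witt_eq:
  assumes four: "of_int 4 ^ L \<approx> 1"
  shows "(\<Sum>k<q - 1. (of_int 4 * Y ^ k * (1 - Y ^ k)) ^ L)
    \<approx> of_int (- (\<Sum>s | s \<le> L \<and> (q - 1) dvd s + L. int (L choose s) * (- 1) ^ s))"
proof -
  have "(of_int 4 * Y ^ k * (1 - Y ^ k)) ^ L
      \<approx> (\<Sum>s\<le>L. of_int (int (L choose s) * (- 1) ^ s) * (Y ^ (s + L)) ^ k)" for k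
  proof -
    have "(of_int 4 * Y ^ k * (1 - Y ^ k)) ^ L = of_int 4 ^ L * ((Y ^ k) ^ L * (- (Y ^ k) + 1) ^ L)"
      by (simp add: power_mult_distrib)
    also have "\<dots> \<approx> 1 * ((Y ^ k) ^ L * (- (Y ^ k) + 1) ^ L)"
      by (intro witt_eq_mult four witt_eq_refl)
    also have "1 * ((Y ^ k) ^ L * (- (Y ^ k) + 1) ^ L)
        = (\<Sum>s\<le>L. (Y ^ k) ^ L * (of_nat (L choose s) * (- (Y ^ k)) ^ s))"
      unfolding binomial_ring[of "- (Y ^ k)" 1 L] sum_distrib_left by simp
    also have "\<dots> = (\<Sum>s\<le>L. of_int (int (L choose s) * (- 1) ^ s) * (Y ^ (s + L)) ^ k)"
    proof (rule sum.cong)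
      fix s
      have "(- (Y ^ k)) ^ s = (- 1) ^ s * (Y ^ k) ^ s" by (rule power_minus)
      moreover have "(Y ^ k) ^ L * (Y ^ k) ^ s = (Y ^ (s + L)) ^ k"
        by (simp add: power_mult[symmetric] power_add[symmetric] algebra_simps)
      ultimately show "(Y ^ k) ^ L * (of_nat (L choose s) * (- (Y ^ k)) ^ s)
         = of_int (int (L choose s) * (- 1) ^ s) * (Y ^ (s + L)) ^ k"
        by (simp add: mult_ac)
    qed simp
    finally show ?thesis .
  qed
  then have "(\<Sum>k<q - 1. (of_int 4 * Y ^ k * (1 - Y ^ k)) ^ L)
    \<approx> (\<Sum>k<q - 1. \<Sum>s\<le>L. of_int (int (L choose s) * (- 1) ^ s) * (Y ^ (s + L)) ^ k)"
    by (intro witt_eq_sum)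
  also have "\<dots> = (\<Sum>s\<le>L. of_int (int (L choose s) * (- 1) ^ s) * (\<Sum>k<q - 1. (Y ^ (s + L)) ^ k))"
    by (subst sum.swap) (simp add: sum_distrib_left)
  also have "\<dots> \<approx> (\<Sum>s\<le>L. of_int (int (L choose s) * (- 1) ^ s) * (if (q - 1) dvd s + L then -1 else 0))"
    by (intro witt_eq_sum witt_eq_mult Y_power_sum witt_eq_refl)
  also have "\<dots> = (\<Sum>s\<in>{..L} \<inter> {s. (q - 1) dvd s + L}. - of_int (int (L choose s) * (- 1) ^ s))"
    by (subst sum.inter_restrict) (auto intro!: sum.cong)
  also have "{..L} \<inter> {s. (q - 1) dvd s + L} = {s. s \<le> L \<and> (q - 1) dvd s + L}" by auto
  also have "(\<Sum>s\<in>\<dots>. - of_int (int (L choose s) * (- 1) ^ s) :: int poly)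
     = of_int (- (\<Sum>s | s \<le> L \<and> (q - 1) dvd s + L. int (L choose s) * (- 1) ^ s))"
    by (simp add: sum_negf)
  finally show ?thesis .
qed

text \<open>
  The surviving exponents are multiples of \<open>m\<close>; since \<open>m\<close> is even, all signs are positive.
\<close>
lemma jacobi_exponents:
  assumes l: "l > 0" and ev: "even m" and a: "[p * l + a = 0] (mod 3)" "a < 3" 
    and n: "\<And>j. 3 * j + a \<le> l * p \<longleftrightarrow> j < n"
  shows "(\<Sum>s | s \<le> l * (p * m) \<and> (q - 1) dvd s + l * (p * m). int (l * (p * m) choose s) * (- 1) ^ s)
     = (\<Sum>j<n. int (l * (p * m) choose ((3 * j + a) * m)))"
proof -
  have m3: "q - 1 = 3 * m" using q_m by simp
  have "{s. s \<le> l * (p * m) \<and> (q - 1) dvd s + l * (p * m)} = (\<lambda>j. (3 * j + a) * m) ` {..<n}"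
  proof (intro equalityI subsetI)
    fix s assume s: "s \<in> {s. s \<le> l * (p * m) \<and> (q - 1) dvd s + l * (p * m)}"
    then have "m dvd s + (l * p) * m" unfolding m3 by (auto simp: mult.assoc dest: dvd_mult_right)
    then have "m dvd s" by (simp add: dvd_add_left_iff)
    then obtain t where t: "s = t * m" by (metis dvdE mult.commute)
    have "3 * m dvd (t + l * p) * m" using s unfolding m3 t by (simp add: algebra_simps)
    then have "3 dvd t + l * p" using m_pos by simp
    then have "t mod 3 = a"
      using a unfolding Cong.cong_def by (simp add: mult.commute) presburger
    then have ta: "t = 3 * (t div 3) + a" by (metis mult_div_mod_eq)
    have "t \<le> l * p" using s m_pos unfolding t by (simp add: mult.assoc[symmetric])
    then have "t div 3 < n" using n ta by metis
    then show "s \<in> (\<lambda>j. (3 * j + a) * m) ` {..<n}" using t ta by auto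
  next
    fix s assume "s \<in> (\<lambda>j. (3 * j + a) * m) ` {..<n}"
    then obtain j where j: "j < n" "s = (3 * j + a) * m" by blast
    have "(3 * j + a) * m \<le> l * p * m" using j n by (intro mult_right_mono) auto
    moreover have "3 dvd (3 * j + a) + l * p"
      using a(1) by (simp add: cong_0_iff algebra_simps) presburger
    then have "3 * m dvd ((3 * j + a) + l * p) * m" by simp
    ultimately show "s \<in> {s. s \<le> l * (p * m) \<and> (q - 1) dvd s + l * (p * m)}"
      unfolding m3 j by (simp add: algebra_simps)
  qed
  moreover have "inj_on (\<lambda>j. (3 * j + a) * m) {..<n}" using m_pos by (auto simp: inj_on_def)
  ultimately show ?thesis using ev by (simp add: sum.reindex)
qed

text \<open>
  The two sums are, up to sign, the two cubic Jacobi sums modulo \<open>p\<^sup>2\<close>. The factor 4 left over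
  from completing the square is invisible to the cubic characters because \<open>4\<^sup>m = 1\<close> in the field.
\<close>
lemma card_weierstrass_points_cong:
  assumes pc: "p = 3 * c + 1" and pm: "(p - 1) dvd m" and ev: "even m" and four: "4 dvd q - 1"
  shows "[card (weierstrass_points R \<zero> (\<ominus> \<one>)) + (\<Sum>j<c. p * m choose ((3 * j + 2) * m))
      + (\<Sum>j\<le>2*c. p * (2 * m) choose ((3 * j + 1) * m)) = 1] (mod p\<^sup>2)"
proof -
  define S1 where "S1 = (\<Sum>j<c. p * m choose ((3 * j + 2) * m))"
  define S2 where "S2 = (\<Sum>j\<le>2*c. p * (2 * m) choose ((3 * j + 1) * m))"
  define V where "V k = of_int 4 * Y ^ k * (1 - Y ^ k)" for k
  let ?f = "\<lambda>z. card (cube_roots (emb 4 \<otimes> z \<otimes> (\<one> \<ominus> z)))"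
  \<comment> \<open>\<open>p - 1\<close> divides \<open>m\<close>, so elements of the prime field are cubes\<close>
  have four_pow: "(of_int 4 ^ (p * m) :: int poly) \<approx> 1"
  proof -
    obtain t where t: "m = (p - 1) * t" using pm by blast
    have "\<not> p dvd 4"
    proof
      assume "p dvd 4"
      then have "p \<le> 4" by (simp add: dvd_imp_le)
      then have "c = 0 \<or> c = 1" using pc by auto
      then show False using pc p_ge_2 p_odd by auto
    qed
    then have "[(4 ^ (p - 1)) ^ t = 1 ^ t] (mod p)" by (intro cong_pow fermat_theorem p)
    then have "[int (4 ^ m) = int 1] (mod int p)" unfolding cong_int_iff by (simp add: t power_mult)
    then have "int p dvd 4 ^ m - 1" by (simp add: cong_iff_dvd_diff)
    then have "ev (of_int (4 ^ m - 1)) = \<zero>" by (simp only: ev_of_int emb_eq_0_iff)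
    then have "ev (of_int 4 ^ m) = ev 1" by (simp add: ev_diff_eq_0_iff)
    then have "(of_int 4 ^ m) ^ p \<approx> 1 ^ p" by (rule ev_eq_imp_power_witt_eq)
    then show ?thesis by (simp add: power_mult[symmetric] mult.commute)
  qed
  have S1: "(\<Sum>k<q - 1. V k ^ (p * m)) \<approx> of_int (- int S1)"
  proof -
    have "(\<Sum>s | s \<le> 1 * (p * m) \<and> (q - 1) dvd s + 1 * (p * m). int (1 * (p * m) choose s) * (- 1) ^ s)
       = (\<Sum>j<c. int (1 * (p * m) choose ((3 * j + 2) * m)))"
    proof (rule jacobi_exponents[OF _ ev])
      have "p * 1 + 2 = 3 * (1 * c + 1)" unfolding pc by simp
      then show "[p * 1 + 2 = 0] (mod 3)" unfolding cong_0_iff by (metis dvd_triv_left)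
      show "3 * j + 2 \<le> 1 * p \<longleftrightarrow> j < c" for j unfolding pc by arith
    qed simp_all
    then show ?thesis using jacobi_sum_witt_eq[OF four_pow] by (simp add: S1_def V_def)
  qed
  have S2: "(\<Sum>k<q - 1. V k ^ (2 * p * m)) \<approx> of_int (- int S2)"
  proof -
    have "(\<Sum>s | s \<le> 2 * (p * m) \<and> (q - 1) dvd s + 2 * (p * m). int (2 * (p * m) choose s) * (- 1) ^ s)
       = (\<Sum>j<2*c+1. int (2 * (p * m) choose ((3 * j + 1) * m)))"
    proof (rule jacobi_exponents[OF _ ev])
      have "p * 2 + 1 = 3 * (2 * c + 1)" unfolding pc by simp
      then show "[p * 2 + 1 = 0] (mod 3)" unfolding cong_0_iff by (metis dvd_triv_left)
      show "3 * j + 1 \<le> 2 * p \<longleftrightarrow> j < 2*c+1" for j unfolding pc by arith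
    qed simp_all
    moreover have "(\<Sum>j<2*c+1. int (2 * (p * m) choose ((3 * j + 1) * m))) = int S2"
    proof -
      have "{..2*c} = {..<2*c+1}" "p * (2 * m) = 2 * (p * m)" by auto
      then show ?thesis unfolding S2_def by (simp only: of_nat_sum)
    qed
    moreover have "of_int 4 ^ (2 * (p * m)) \<approx> 1"
    proof -
      have "(of_int 4 ^ (p * m)) ^ 2 \<approx> 1 ^ 2" by (intro witt_eq_power four_pow)
      then show ?thesis by (simp add: power_mult[symmetric] mult_ac)
    qed
    ultimately show ?thesis using jacobi_sum_witt_eq[of "2 * (p * m)"]
      unfolding V_def mult.assoc[of 2 p m] by (simp only:)
  qed
  have summand: "of_nat (?f (g [^] k)) \<approx> 1 + V k ^ (p * m) + V k ^ (2 * p * m)" for k :: nat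
  proof (rule card_cube_roots_witt_eq)
    show "ev (V k) = emb 4 \<otimes> g [^] k \<otimes> (\<one> \<ominus> g [^] k)"
      unfolding V_def by (simp only: ev_mult ev_diff ev_of_int ev_1 ev_Y_power)
  qed simp
  have "(\<Sum>z\<in>carrier R. ?f z) = ?f \<zero> + (\<Sum>z\<in>carrier R - {\<zero>}. ?f z)"
    using finite_R by (subst sum.remove[of _ "\<zero>"]) auto
  also have "?f \<zero> = 1" using card_cube_roots_0 by simp
  also have "(\<Sum>z\<in>carrier R - {\<zero>}. ?f z) = (\<Sum>k<q - 1. ?f (g [^] k))"
    by (rule sum.reindex_bij_betw[OF gen, symmetric])
  finally have "card (weierstrass_points R \<zero> (\<ominus> \<one>)) = 2 + (\<Sum>k<q - 1. ?f (g [^] k))"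
    unfolding card_weierstrass_points_eq_sum sum_cube_roots_substitution[OF four] by simp
  then have "of_int (int (card (weierstrass_points R \<zero> (\<ominus> \<one>))))
     = (2 + (\<Sum>k<q - 1. of_nat (?f (g [^] k))) :: int poly)" by simp
  also have "\<dots> \<approx> 2 + (\<Sum>k<q - 1. 1 + V k ^ (p * m) + V k ^ (2 * p * m))"
    by (intro witt_eq_add witt_eq_refl witt_eq_sum summand)
  also have "\<dots> = of_nat q + (1 + (\<Sum>k<q - 1. V k ^ (p * m)) + (\<Sum>k<q - 1. V k ^ (2 * p * m)))"
    using q_m by (simp add: sum.distrib)
  also have "\<dots> \<approx> 0 + (1 + of_int (- int S1) + of_int (- int S2))"
    by (intro witt_eq_add S1 S2 witt_eq_refl) (use witt_null_multiple[OF q_div] in \<open>simp add: witt_eq_def\<close>)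
  also have "\<dots> = of_int (1 - int S1 - int S2)" by simp
  finally have "[int (card (weierstrass_points R \<zero> (\<ominus> \<one>))) = 1 - int S1 - int S2] (mod (int p)\<^sup>2)"
    by (rule witt_eq_of_int_cong)
  then have "[int (card (weierstrass_points R \<zero> (\<ominus> \<one>)) + S1 + S2) = int 1] (mod int (p\<^sup>2))"
    by (simp add: cong_iff_dvd_diff algebra_simps)
  then show ?thesis unfolding cong_int_iff S1_def S2_def .
qed

end


section \<open>Rational numbers integral at a prime\<close>

lemma p_integral_iff:
  assumes p: "Factorial_Ring.prime (p::nat)"
  shows "p_integral p x \<longleftrightarrow> (\<exists>a b. \<not> int p dvd b \<and> x * of_int b = of_int a)"
proof
  obtain a b where ab: "quotient_of x = (a, b)" by fastforce
  have x: "x = of_int a / of_int b" "b > 0" "coprime a b"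
    using quotient_of_div[OF ab] quotient_of_denom_pos[OF ab] quotient_of_coprime[OF ab] by auto
  show "\<exists>a b. \<not> int p dvd b \<and> x * of_int b = of_int a" if "p_integral p x"
  proof -
    have "coprime b (int p)" using that ab by (simp add: p_integral_def)
    then have "\<not> int p dvd b"
      using p by (metis coprime_absorb_right not_prime_unit prime_nat_int_transfer)
    then show ?thesis using x by (intro exI[of _ a] exI[of _ b]) simp
  qed
  show "p_integral p x" if ex: "\<exists>a b. \<not> int p dvd b \<and> x * of_int b = of_int a"
  proof -
    obtain a' b' where ab': "\<not> int p dvd b'" "x * of_int b' = of_int a'" using ex by blast
    have "of_int (a * b') = (of_int (a' * b) :: rat)"
      using ab'(2) x by (simp add: field_simps)
    then have "a * b' = a' * b" by (simp only: of_int_eq_iff)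
    then have "b dvd b'" using x(3) by (metis coprime_dvd_mult_right_iff coprime_commute dvd_triv_right)
    then have "\<not> int p dvd b" using ab'(1) dvd_trans by blast
    then have "coprime b (int p)" using p by (metis coprime_commute prime_imp_coprime prime_nat_int_transfer)
    then show ?thesis by (simp add: p_integral_def ab)
  qed
qed

lemma p_integral_of_int [simp]: "p_integral p (of_int a)"
  by (simp add: p_integral_def)

lemma p_integral_add:
  assumes p: "Factorial_Ring.prime (p::nat)" and "p_integral p x" "p_integral p y"
  shows "p_integral p (x + y)"
proof -
  obtain a b a' b' where ab: "\<not> int p dvd b" "x * of_int b = of_int a" "\<not> int p dvd b'" "y * of_int b' = of_int a'"
    using assms p_integral_iff[OF p] by metis
  have "\<not> int p dvd b * b'" using ab p by (simp add: prime_dvd_mult_iff)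
  moreover have "(x + y) * of_int (b * b') = (x * of_int b) * of_int b' + (y * of_int b') * of_int b"
    by (simp add: algebra_simps)
  then have "(x + y) * of_int (b * b') = of_int (a * b' + a' * b)"
    unfolding ab by simp
  ultimately show ?thesis using p_integral_iff[OF p] by blast
qed

lemma p_integral_mult:
  assumes p: "Factorial_Ring.prime (p::nat)" and "p_integral p x" "p_integral p y"
  shows "p_integral p (x * y)"
proof -
  obtain a b a' b' where ab: "\<not> int p dvd b" "x * of_int b = of_int a" "\<not> int p dvd b'" "y * of_int b' = of_int a'"
    using assms p_integral_iff[OF p] by metis
  have "\<not> int p dvd b * b'" using ab p by (simp add: prime_dvd_mult_iff)
  moreover have "(x * y) * of_int (b * b') = (x * of_int b) * (y * of_int b')"
    by (simp add: algebra_simps)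
  then have "(x * y) * of_int (b * b') = of_int (a * a')"
    unfolding ab by simp
  ultimately show ?thesis using p_integral_iff[OF p] by blast
qed

lemma p_integral_divide:
  assumes p: "Factorial_Ring.prime (p::nat)" and "p_integral p x" "\<not> p dvd n"
  shows "p_integral p (x / of_nat n)"
proof -
  obtain a b where ab: "\<not> int p dvd b" "x * of_int b = of_int a"
    using assms p_integral_iff[OF p] by metis
  have "\<not> int p dvd b * int n" using ab p assms by (simp add: prime_dvd_mult_iff)
  moreover have "n \<noteq> 0" using assms(3) by (metis dvd_0_right)
  then have "(x / of_nat n) * of_int (b * int n) = of_int a"
    unfolding ab(2)[symmetric] by simp
  ultimately show ?thesis using p_integral_iff[OF p] by blast
qed

definition p_divides :: "nat \<Rightarrow> nat \<Rightarrow> rat \<Rightarrow> bool" where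
  "p_divides p k x \<longleftrightarrow> (\<exists>z. p_integral p z \<and> x = of_nat p ^ k * z)"

context
  fixes p :: nat
  assumes p: "Factorial_Ring.prime p"
begin

lemma p_divides_add: "p_divides p k x \<Longrightarrow> p_divides p k y \<Longrightarrow> p_divides p k (x + y)"
  unfolding p_divides_def using p_integral_add[OF p] by (metis distrib_left)

lemma p_divides_mult:
  assumes "p_divides p k x" "p_integral p y"
  shows "p_divides p k (x * y)"
proof -
  obtain z where "p_integral p z" "x = of_nat p ^ k * z" using assms by (auto simp: p_divides_def)
  then have "p_integral p (z * y)" "x * y = of_nat p ^ k * (z * y)"
    using p_integral_mult[OF p] assms(2) by (auto simp: mult.assoc)
  then show ?thesis unfolding p_divides_def by blast
qed

lemma p_divides_uminus: "p_divides p k x \<Longrightarrow> p_divides p k (- x)"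
  using p_divides_mult[of k x "of_int (- 1)", OF _ p_integral_of_int] by simp

lemma p_divides_diff: "p_divides p k x \<Longrightarrow> p_divides p k y \<Longrightarrow> p_divides p k (x - y)"
  using p_divides_add[of k x "- y"] p_divides_uminus by simp

lemma p_divides_0: "p_divides p k 0"
  unfolding p_divides_def using p_integral_of_int[of p 0] by (intro exI[of _ 0]) simp

lemma p_divides_sum: "(\<And>i. i \<in> S \<Longrightarrow> p_divides p k (f i)) \<Longrightarrow> p_divides p k (\<Sum>i\<in>S. f i)"
  by (induction S rule: infinite_finite_induct) (auto intro: p_divides_add p_divides_0)

lemma p_divides_divide: "p_divides p k x \<Longrightarrow> \<not> p dvd n \<Longrightarrow> p_divides p k (x / of_nat n)"
  using p_divides_mult[of k x "1 / of_nat n"] p_integral_divide[OF p, of 1 n] p_integral_of_int[of p 1]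
  by simp

lemma p_divides_of_int: "int p ^ k dvd a \<Longrightarrow> p_divides p k (of_int a)"
  unfolding p_divides_def by (elim dvdE) (auto intro!: exI[of _ "of_int _"])

lemma p_divides_of_int_iff: "p_divides p k (of_int a) \<longleftrightarrow> int p ^ k dvd a"
proof
  assume "p_divides p k (of_int a)"
  then obtain z where z: "p_integral p z" "of_int a = of_nat p ^ k * z" by (auto simp: p_divides_def)
  obtain u v where uv: "\<not> int p dvd v" "z * of_int v = of_int u"
    using z(1) p_integral_iff[OF p] by blast
  have "(of_int (a * v) :: rat) = of_nat p ^ k * (z * of_int v)" by (simp add: z(2))
  also have "\<dots> = of_int (int p ^ k * u)" unfolding uv(2) by simp
  finally have "a * v = int p ^ k * u" by (simp only: of_int_eq_iff)
  then have "int p ^ k dvd a * v" by simp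
  moreover have "coprime (int p ^ k) v" using uv(1) p by (simp add: prime_imp_coprime)
  ultimately show "int p ^ k dvd a" by (simp add: coprime_dvd_mult_left_iff)
qed (rule p_divides_of_int)

lemma p_divides_imp_integral: "p_divides p k x \<Longrightarrow> p_integral p x"
  unfolding p_divides_def using p_integral_mult[OF p] p_integral_of_int[of p "int p ^ k"] by auto

lemma p_integral_cong_0_iff: "p_integral_cong p x 0 (p\<^sup>2) \<longleftrightarrow> p_divides p 2 x"
  using p_divides_imp_integral[of 2 x] p_integral_of_int[of p 0]
  by (auto simp: p_integral_cong_def p_divides_def)

end

section \<open>Glaisher numbers and power sums\<close>

text \<open>
  With \<open>F = 1 / (e\<^sup>x + e\<^bsup>-x\<^esup> + 1) = (e\<^bsup>2x\<^esup> - e\<^sup>x) / (e\<^bsup>3x\<^esup> - 1)\<close> and geometric sums of step 3, everything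
  acquires the common denominator \<open>e\<^bsup>3x\<^esup> - 1\<close>. Symmetrising \<open>x \<rightarrow> -x\<close> in the power sum is what makes
  the numerator vanish when \<open>P\<close> is replaced by 0.
\<close>
lemma glaisher_power_sum_series:
  fixes N :: nat
  defines "P \<equiv> of_nat (3 * N + 1) :: rat"
  defines "D \<equiv> (\<Sum>i\<le>N. fps_exp (3 * of_nat i)) + (\<Sum>i\<le>N. fps_exp (- (3 * of_nat i))) - 1
     - inverse (fps_exp 1 + fps_exp (- 1) + 1 :: rat fps)"
  shows "D * (fps_exp 3 - 1) = fps_exp (P + 2) - fps_exp 2 - (fps_exp (1 - P) - fps_exp 1)"
proof -
  have E: "fps_exp a * fps_exp b = (fps_exp (a + b) :: rat fps)" for a b
    by (rule fps_exp_add_mult[symmetric])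
  have A: "(\<Sum>i\<le>n. fps_exp (3 * of_nat i)) * (fps_exp 3 - 1) = (fps_exp (3 * of_nat n + 3) - 1 :: rat fps)" for n
  proof (induction n)
    case (Suc n)
    have e: "3 * of_nat (Suc n) = (3 * of_nat n + 3 :: rat)" by simp
    show ?case unfolding sum.atMost_Suc distrib_right Suc.IH unfolding e right_diff_distrib mult_1_right E by simp
  qed simp
  have B: "(\<Sum>i\<le>n. fps_exp (- (3 * of_nat i))) * (fps_exp 3 - 1) = (fps_exp 3 - fps_exp (- (3 * of_nat n)) :: rat fps)" for n
  proof (induction n)
    case (Suc n)
    have e: "- (3 * of_nat (Suc n)) + 3 = (- (3 * of_nat n) :: rat)" by simp
    show ?case unfolding sum.atMost_Suc distrib_right Suc.IH unfolding right_diff_distrib mult_1_right E e by simp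
  qed simp
  let ?U = "fps_exp 1 + fps_exp (- 1) + 1 :: rat fps"
  have eq: "(fps_exp 2 - fps_exp 1) * ?U = (fps_exp 3 - 1 :: rat fps)"
    unfolding distrib_left left_diff_distrib E mult_1_right by simp
  have "inverse ?U * (fps_exp 3 - 1) = (fps_exp 2 - fps_exp 1) * (inverse ?U * ?U)"
    unfolding eq[symmetric] by (simp only: mult_ac)
  also have "inverse ?U * ?U = 1" by (rule inverse_mult_eq_1) simp
  finally have C: "inverse ?U * (fps_exp 3 - 1) = (fps_exp 2 - fps_exp 1 :: rat fps)"
    by (simp only: mult_1_right)
  have "D * (fps_exp 3 - 1) = (fps_exp (3 * of_nat N + 3) - 1) + (fps_exp 3 - fps_exp (- (3 * of_nat N)))
     - 1 * (fps_exp 3 - 1) - (fps_exp 2 - fps_exp 1)"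
    unfolding D_def A[symmetric] B[symmetric] C[symmetric]
    by (simp only: left_diff_distrib distrib_right mult_1)
  also have "\<dots> = fps_exp (P + 2) - fps_exp 2 - (fps_exp (1 - P) - fps_exp 1)"
  proof -
    have "3 * of_nat N + 3 = P + 2" "- (3 * of_nat N) = 1 - P" by (simp_all add: P_def)
    then show ?thesis by simp
  qed
  finally show ?thesis .
qed

lemma power_prime_diff_dvd:
  fixes x y :: int
  assumes p: "Factorial_Ring.prime (p::nat)" and xy: "int p ^ 2 dvd x - y"
  shows "int p ^ 3 dvd x ^ p - y ^ p"
proof -
  have "[x = y] (mod int p)"
    using xy by (metis cong_iff_dvd_diff dvd_power dvd_trans zero_less_numeral)
  then have "[(\<Sum>i<p. y ^ (p - Suc i) * x ^ i) = (\<Sum>i<p. y ^ (p - Suc i) * y ^ i)] (mod int p)"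
    by (intro cong_sum cong_mult cong_pow cong_refl)
  also have "(\<Sum>i<p. y ^ (p - Suc i) * y ^ i) = (\<Sum>i<p. y ^ (p - 1))"
    by (intro sum.cong) (auto simp: power_add[symmetric])
  also have "[(\<Sum>i<p. y ^ (p - 1)) = 0] (mod int p)" by (simp add: cong_0_iff)
  finally have "int p dvd (\<Sum>i<p. y ^ (p - Suc i) * x ^ i)" by (simp add: cong_0_iff)
  with xy have "int p ^ 2 * int p dvd (x - y) * (\<Sum>i<p. y ^ (p - Suc i) * x ^ i)" by (intro mult_dvd_mono)
  then show ?thesis by (simp add: power_diff_sumr2 power2_eq_square power3_eq_cube)
qed

lemma not_prime_dvd_fact: "Factorial_Ring.prime (p::nat) \<Longrightarrow> n < p \<Longrightarrow> \<not> p dvd fact n"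
  by (simp add: prime_dvd_fact_iff)

text \<open>
  The coefficients \<open>d\<^sub>n\<close> of the difference \<open>D\<close> between power sums and generating function satisfy
  the recursion obtained from \<open>D (e\<^bsup>3x\<^esup> - 1)\<close>, whose right-hand side is divisible by \<open>p\<^sup>2\<close>. As long
  as the denominators are prime to \<open>p\<close>, that is for \<open>n < p - 1\<close>, divisibility passes to \<open>d\<^sub>n\<close>. At
  \<open>n = p - 1\<close> exactly two terms have a \<open>p!\<close> in the denominator: the one on the right-hand side gains
  another \<open>p\<close> by \<open>p\<close>-th powers, and the one with \<open>d\<^sub>0 = 2p\<^sup>2/3\<close> is the source of the summand \<open>p\<close> in
  the claim (as in von Staudt's theorem for Bernoulli numbers).
\<close>
lemma glaisher_cong:
  assumes p: "Factorial_Ring.prime (p::nat)" and p5: "p \<ge> 5" and N: "p\<^sup>2 = 3 * N + 1"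
  shows "p_divides p 2 (glaisher (p - 1) - of_int (3 ^ (p - 1) * (3 * (\<Sum>i\<le>N. int i ^ (p - 1)) + int p)))"
proof -
  define U where "U = (fps_exp 1 + fps_exp (- 1) + 1 :: rat fps)"
  define D where "D = (\<Sum>i\<le>N. fps_exp (3 * of_nat i)) + (\<Sum>i\<le>N. fps_exp (- (3 * of_nat i))) - 1 - inverse U"
  define d where "d n = fps_nth D n" for n
  define r where "r k = ((of_nat p ^ 2 + 2) ^ k - 2 ^ k - ((1 - of_nat p ^ 2) ^ k - 1) :: rat)" for k
  have P: "(of_nat (3 * N + 1) :: rat) = of_nat p ^ 2" unfolding N[symmetric] by simp
  have series: "D * (fps_exp 3 - 1) = fps_exp (of_nat p ^ 2 + 2) - fps_exp 2 - (fps_exp (1 - of_nat p ^ 2) - fps_exp 1)"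
    using glaisher_power_sum_series[of N] unfolding P D_def U_def .
  have rec: "(\<Sum>i\<le>n. d i * (3 ^ (Suc n - i) / fact (Suc n - i))) = r (Suc n) / fact (Suc n)" for n
  proof -
    have "fps_nth (D * (fps_exp 3 - 1)) (Suc n) = (\<Sum>i\<le>Suc n. d i * fps_nth (fps_exp 3 - 1) (Suc n - i))"
      by (simp add: fps_mult_nth d_def atLeast0AtMost)
    also have "\<dots> = (\<Sum>i\<le>n. d i * fps_nth (fps_exp 3 - 1) (Suc n - i))" by simp
    also have "\<dots> = (\<Sum>i\<le>n. d i * (3 ^ (Suc n - i) / fact (Suc n - i)))"
      by (intro sum.cong) auto
    finally show ?thesis unfolding series r_def
      by (simp only: fps_sub_nth fps_exp_nth diff_divide_distrib power_one of_nat_fact)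
  qed
  \<comment> \<open>solved for the last coefficient\<close>
  have rec': "3 * d n = r (Suc n) / fact (Suc n) - (\<Sum>i<n. d i * (3 ^ (Suc n - i) / fact (Suc n - i)))" for n
    using rec[of n] by (simp add: lessThan_Suc_atMost[symmetric])
  define ri where "ri k = (int p ^ 2 + 2) ^ k - 2 ^ k - ((1 - int p ^ 2) ^ k - 1 ^ k)" for k
  have r_ri: "r k = of_int (ri k)" for k by (simp add: r_def ri_def)
  have pd: "x - y dvd x ^ k - y ^ k" for x y :: int and k
    by (metis power_diff_sumr2 dvd_triv_left)
  have ri2: "int p ^ 2 dvd ri k" for k
    unfolding ri_def
  proof (rule dvd_diff)
    show "int p ^ 2 dvd (int p ^ 2 + 2) ^ k - 2 ^ k"
      using pd[of "int p ^ 2 + 2" 2 k] by simp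
    show "int p ^ 2 dvd (1 - int p ^ 2) ^ k - 1 ^ k"
      using pd[of "1 - int p ^ 2" 1 k] by simp
  qed
  \<comment> \<open>\<open>p\<close>-th powers of numbers congruent modulo \<open>p\<^sup>2\<close> are congruent modulo \<open>p\<^sup>3\<close>\<close>
  have ri3: "int p ^ 3 dvd ri p"
    unfolding ri_def by (rule dvd_diff; rule power_prime_diff_dvd[OF p]; simp)
  have term_div: "p_divides p 2 (x * (3 ^ j / fact j))" if "p_divides p 2 x" "j < p" for x j
  proof -
    have "p_divides p 2 (x * of_int (3 ^ j))" by (intro p_divides_mult[OF p] that p_integral_of_int)
    from p_divides_divide[OF p this not_prime_dvd_fact[OF p that(2)]] show ?thesis by simp
  qed
  have n3: "\<not> p dvd 3" using p5 by (auto dest: dvd_imp_le)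
  have d_small: "p_divides p 2 (d n)" if "n < p - 1" for n
    using that
  proof (induction n rule: less_induct)
    case (less n)
    have "p_divides p 2 (r (Suc n) / of_nat (fact (Suc n)))"
      unfolding r_ri using less.prems
      by (intro p_divides_divide[OF p] p_divides_of_int[OF p] ri2 not_prime_dvd_fact[OF p]) simp
    moreover have "p_divides p 2 (\<Sum>i<n. d i * (3 ^ (Suc n - i) / fact (Suc n - i)))"
      using less by (intro p_divides_sum[OF p] term_div) auto
    ultimately have "p_divides p 2 (3 * d n)"
      unfolding rec'[of n] using p_divides_diff[OF p] by (simp only: of_nat_fact)
    from p_divides_divide[OF p this n3] show ?case by simp
  qed
  have d0: "3 * d 0 = 2 * of_nat p ^ 2"
    using rec'[of 0] by (simp add: r_def)
  define n where "n = p - 1"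
  have n: "p = Suc n" "n > 0" using p5 by (auto simp: n_def)
  have fact_p: "(fact p :: rat) = of_nat p * fact n" unfolding n(1) fact_Suc by simp
  have split0: "(\<Sum>i<n. d i * (3 ^ (Suc n - i) / fact (Suc n - i)))
      = d 0 * (3 ^ p / fact p) + (\<Sum>i\<in>{1..<n}. d i * (3 ^ (Suc n - i) / fact (Suc n - i)))"
    using n by (simp add: lessThan_atLeast0 sum.atLeast_Suc_lessThan)
  have rp: "p_divides p 2 (r p / of_nat (fact p))"
  proof -
    obtain t where t: "ri p = int p ^ 3 * t" using ri3 by blast
    have "r p / of_nat (fact p) = of_int (int p ^ 2 * t) / of_nat (fact n)"
      unfolding r_ri t of_nat_fact fact_p using n by (simp add: power2_eq_square power3_eq_cube)
    moreover have "p_divides p 2 (of_int (int p ^ 2 * t) / of_nat (fact n))"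
      by (intro p_divides_divide[OF p] p_divides_of_int[OF p] not_prime_dvd_fact[OF p]) (use n in auto)
    ultimately show ?thesis by simp
  qed
  have mid: "p_divides p 2 (\<Sum>i\<in>{1..<n}. d i * (3 ^ (Suc n - i) / fact (Suc n - i)))"
    by (intro p_divides_sum[OF p] term_div d_small) (use n in auto)
  have "3 * d n + d 0 * (3 ^ p / fact p) = r p / of_nat (fact p) - (\<Sum>i\<in>{1..<n}. d i * (3 ^ (Suc n - i) / fact (Suc n - i)))"
    using rec'[of n, unfolded split0] unfolding n(1)[symmetric] of_nat_fact by (simp only:)
  then have "p_divides p 2 (3 * d n + d 0 * (3 ^ p / fact p))"
    using p_divides_diff[OF p rp mid] by simp
  then have "p_divides p 2 ((3 * d n + d 0 * (3 ^ p / fact p)) * of_int (fact n))"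
    by (intro p_divides_mult[OF p] p_integral_of_int)
  also have "(3 * d n + d 0 * (3 ^ p / fact p)) * of_int (fact n)
      = 3 * (fact n * d n) + d 0 * (3 ^ p / fact p) * fact n"
    by (simp only: of_int_fact distrib_right mult.assoc mult.commute[of "fact n" "d n"])
  also have "d 0 * (3 ^ p / fact p) * fact n = 2 * of_nat p * 3 ^ n"
  proof -
    have "(3::rat) ^ p = 3 * 3 ^ n" unfolding n(1) by (rule power_Suc)
    moreover have "(of_nat p :: rat) \<noteq> 0" using n by simp
    ultimately have "d 0 * (3 ^ p / fact p) * fact n = (3 * d 0) * 3 ^ n / of_nat p"
      unfolding fact_p by simp
    also have "\<dots> = 2 * of_nat p * 3 ^ n"
      unfolding d0 power2_eq_square using \<open>(of_nat p :: rat) \<noteq> 0\<close> by simp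
    finally show ?thesis .
  qed
  finally have main: "p_divides p 2 (3 * (fact n * d n) + 2 * of_nat p * 3 ^ n)" .
  have dn: "fact n * d n = 2 * (3 ^ n * (\<Sum>i\<le>N. of_nat i ^ n)) - fact n * fps_nth (inverse U) n"
  proof -
    have "even n"
    proof -
      have "odd p" using p5 by (intro prime_odd_nat p) simp
      then show ?thesis using n by simp
    qed
    then have "(- (3 * of_nat i)) ^ n = ((3 * of_nat i) ^ n :: rat)" for i :: nat by simp
    moreover have "fps_nth (1 :: rat fps) n = 0" using n by simp
    ultimately have "d n = 2 * (\<Sum>i\<le>N. (3 * of_nat i) ^ n / fact n) - fps_nth (inverse U) n"
      unfolding d_def D_def by (simp add: fps_sum_nth)
    also have "(\<Sum>i\<le>N. (3 * of_nat i) ^ n / fact n :: rat) = 3 ^ n * (\<Sum>i\<le>N. of_nat i ^ n) / fact n"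
      unfolding power_mult_distrib sum_divide_distrib[symmetric] sum_distrib_left[symmetric] ..
    finally have "fact n * d n = fact n * (2 * (3 ^ n * (\<Sum>i\<le>N. of_nat i ^ n) / fact n)) - fact n * fps_nth (inverse U) n"
      by (simp only: right_diff_distrib)
    then show ?thesis by simp
  qed
  have U0: "fps_nth U 0 \<noteq> 0" by (simp add: U_def)
  have G: "glaisher n = 3 / 2 * (fact n * fps_nth (inverse U) n)"
    unfolding glaisher_def U_def[symmetric] fps_divide_unit[OF U0] by simp
  have "glaisher n - of_int (3 ^ n * (3 * (\<Sum>i\<le>N. int i ^ n) + int p))
      = - ((3 * (fact n * d n) + 2 * of_nat p * 3 ^ n) / of_nat 2)"
  proof -
    have "(of_int (3 ^ n * (3 * (\<Sum>i\<le>N. int i ^ n) + int p)) :: rat) = 3 ^ n * (3 * (\<Sum>i\<le>N. of_nat i ^ n) + of_nat p)"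
      by simp
    moreover have "3 / 2 * u - t * (3 * S + P) = - ((3 * (2 * (t * S) - u) + 2 * P * t) / of_nat 2)"
      for u t S P :: rat by (simp add: field_simps)
    ultimately show ?thesis unfolding G dn by (simp only:)
  qed
  moreover have "\<not> p dvd 2" using p5 by (auto dest: dvd_imp_le)
  ultimately have "p_divides p 2 (glaisher n - of_int (3 ^ n * (3 * (\<Sum>i\<le>N. int i ^ n) + int p)))"
    using p_divides_uminus[OF p p_divides_divide[OF p main, of 2]] by (simp only: not_False_eq_True)
  then show ?thesis by (simp only: n_def)
qed

section \<open>The three conditions\<close>

lemma prod_cong_1_add_sum:
  fixes f :: "'i \<Rightarrow> int"
  assumes "finite T" "\<And>a. a \<in> T \<Longrightarrow> n dvd f a - 1"
  shows "[(\<Prod>a\<in>T. f a) = 1 + (\<Sum>a\<in>T. f a - 1)] (mod n\<^sup>2) \<and> n dvd (\<Sum>a\<in>T. f a - 1)"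
  using assms
proof (induction T rule: finite_induct)
  case (insert a T)
  let ?S = "\<Sum>a\<in>T. f a - 1"
  have IH: "[(\<Prod>a\<in>T. f a) = 1 + ?S] (mod n\<^sup>2)" "n dvd ?S" and a: "n dvd f a - 1"
    using insert by auto
  have "[f a * (\<Prod>a\<in>T. f a) = f a * (1 + ?S)] (mod n\<^sup>2)" by (intro cong_mult cong_refl IH)
  also have "[f a * (1 + ?S) = 1 + ((f a - 1) + ?S)] (mod n\<^sup>2)"
  proof -
    have "f a * (1 + ?S) - (1 + ((f a - 1) + ?S)) = (f a - 1) * ?S" by (simp add: algebra_simps)
    then show ?thesis unfolding cong_iff_dvd_diff power2_eq_square using a IH(2) by (metis mult_dvd_mono)
  qed
  finally show ?case using insert IH(2) a by simp
qed simp

lemma card_coprime_upto: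
  assumes p: "Factorial_Ring.prime (p::nat)"
  shows "card {a. 1 \<le> a \<and> a \<le> n \<and> coprime a p} + n div p = n"
proof (induction n)
  case 0
  have "{a. 1 \<le> a \<and> a \<le> (0::nat) \<and> coprime a p} = {}" by auto
  then show ?case by (metis card.empty div_0 add_0)
next
  case (Suc n)
  have iff: "coprime (Suc n) p \<longleftrightarrow> \<not> p dvd Suc n"
    using p by (metis coprime_commute prime_imp_coprime coprime_absorb_left not_prime_unit)
  have "{a. 1 \<le> a \<and> a \<le> Suc n \<and> coprime a p}
     = (if p dvd Suc n then {} else {Suc n}) \<union> {a. 1 \<le> a \<and> a \<le> n \<and> coprime a p}"
    using iff by (auto simp: le_Suc_eq)
  then have "card {a. 1 \<le> a \<and> a \<le> Suc n \<and> coprime a p}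
     = (if p dvd Suc n then 0 else 1) + card {a. 1 \<le> a \<and> a \<le> n \<and> coprime a p}"
    by (simp add: card_insert_if)
  moreover have "Suc n div p = (if p dvd Suc n then 1 else 0) + n div p"
    by (simp add: div_Suc dvd_eq_mod_eq_0)
  ultimately show ?case using Suc by (auto split: if_splits)
qed

lemma power_sum_cong:
  assumes p: "Factorial_Ring.prime (p::nat)" and p5: "p \<ge> 5"
  shows "[(\<Sum>i\<le>n. int i ^ (p - 1)) = int n - int (n div p)
     + (\<Sum>a | 1 \<le> a \<and> a \<le> n \<and> coprime a p. int a ^ (p - 1) - 1)] (mod (int p)\<^sup>2)"
proof -
  let ?T = "{a. 1 \<le> a \<and> a \<le> n \<and> coprime a p}"
  have fin: "finite ?T" by simp
  have split: "(\<Sum>i\<le>n. int i ^ (p - 1)) = (\<Sum>i\<in>?T. int i ^ (p - 1)) + (\<Sum>i\<in>{..n} - ?T. int i ^ (p - 1))"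
    by (rule sum.subset_diff[THEN trans[OF _ add.commute]]) auto
  have vanish: "[(\<Sum>i\<in>?T. int i ^ (p - 1)) + (\<Sum>i\<in>{..n} - ?T. int i ^ (p - 1))
      = (\<Sum>i\<in>?T. int i ^ (p - 1)) + (\<Sum>i\<in>{..n} - ?T. 0)] (mod (int p)\<^sup>2)"
  proof (intro cong_add cong_refl cong_sum)
    fix i assume i: "i \<in> {..n} - ?T"
    have "int p dvd int i"
    proof (cases "i = 0")
      case False
      then have "\<not> coprime i p" using i by auto
      then show ?thesis using p by (metis coprime_commute int_dvd_int_iff prime_imp_coprime)
    qed simp
    then have "(int p) ^ (p - 1) dvd int i ^ (p - 1)" by (rule dvd_power_same)
    moreover have "(int p) ^ 2 dvd int p ^ (p - 1)" using p5 by (intro le_imp_power_dvd) simp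
    ultimately show "[int i ^ (p - 1) = 0] (mod (int p)\<^sup>2)" by (metis cong_0_iff dvd_trans)
  qed
  have units: "(\<Sum>i\<in>?T. int i ^ (p - 1)) + (\<Sum>i\<in>{..n} - ?T. 0) = int (card ?T) + (\<Sum>a\<in>?T. int a ^ (p - 1) - 1)"
    by (simp only: sum_subtractf sum.neutral_const sum_constant of_nat_id mult_1_right add_0_right)
  have card: "int (card ?T) = int n - int (n div p)"
    using card_coprime_upto[OF p, of n] by linarith
  show ?thesis using vanish unfolding split[symmetric] units card .
qed

text \<open>
  Every \<open>a\<^bsup>p - 1\<^esup>\<close> is 1 modulo \<open>p\<close>, so modulo \<open>p\<^sup>2\<close> the product of these powers is governed by the
  sum of \<open>a\<^bsup>p - 1\<^esup> - 1\<close>, and up to a power of 3 that sum is \<open>G\<^bsub>p - 1\<^esub>\<close>: there are \<open>pc\<close> numbers prime to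
  \<open>p\<close> in the range, and \<open>3pc = p\<^sup>2 - p\<close> cancels the summand \<open>p\<close>.
\<close>
lemma one_exceptional_iff_glaisher:
  assumes p: "Factorial_Ring.prime (p::nat)" and p5: "p \<ge> 5" and pc: "p = 3 * c + 1"
  shows "one_exceptional p 3 \<longleftrightarrow> p_integral_cong p (glaisher (p - 1)) 0 (p\<^sup>2)"
proof -
  define N where "N = p * c + c"
  have N: "p\<^sup>2 = 3 * N + 1" unfolding N_def power2_eq_square pc by (simp add: algebra_simps)
  have Nd: "N div p = c"
  proof -
    have "(c + p * c) div p = c" using pc by (simp only: div_mult_self2) simp
    then show ?thesis by (simp add: N_def add.commute)
  qed
  let ?T = "{a. 1 \<le> a \<and> a \<le> N \<and> coprime a p}"
  let ?S = "\<Sum>a\<in>?T. int a ^ (p - 1) - 1"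
  have fermat: "int p dvd int a ^ (p - 1) - 1" if "a \<in> ?T" for a
  proof -
    have "\<not> p dvd a" using that p by (metis (mono_tags, lifting) mem_Collect_eq coprime_absorb_right not_prime_unit)
    then have "[int (a ^ (p - 1)) = int 1] (mod int p)" unfolding cong_int_iff by (rule fermat_theorem[OF p])
    then show ?thesis by (simp add: cong_iff_dvd_diff)
  qed
  have pr: "[(\<Prod>a\<in>?T. int a ^ (p - 1)) = 1 + ?S] (mod (int p)\<^sup>2)"
    using prod_cong_1_add_sum[of ?T "int p" "\<lambda>a. int a ^ (p - 1)"] fermat by simp
  have "one_exceptional p 3 \<longleftrightarrow> [int (\<Prod>a\<in>?T. a ^ (p - 1)) = int 1] (mod int (p\<^sup>2))"
    unfolding one_exceptional_def cong_int_iff N by simp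
  also have "\<dots> \<longleftrightarrow> [(\<Prod>a\<in>?T. int a ^ (p - 1)) = 1] (mod (int p)\<^sup>2)" by simp
  also have "\<dots> \<longleftrightarrow> [1 + ?S = 1] (mod (int p)\<^sup>2)" using pr by (meson cong_sym cong_trans)
  also have "\<dots> \<longleftrightarrow> (int p)\<^sup>2 dvd ?S" by (simp add: cong_iff_dvd_diff)
  finally have one: "one_exceptional p 3 \<longleftrightarrow> (int p)\<^sup>2 dvd ?S" .
  have cop3: "coprime ((int p)\<^sup>2) 3"
  proof -
    have "\<not> p dvd 3" using p5 by (auto dest: dvd_imp_le)
    then have "coprime p 3" using p by (rule prime_imp_coprime[rotated])
    then have "coprime (int p) (int 3)" by (simp only: coprime_int_iff)
    then show ?thesis by simp
  qed
  have cg: "[3 * (\<Sum>i\<le>N. int i ^ (p - 1)) + int p = 3 * (int N - int c + ?S) + int p] (mod (int p)\<^sup>2)"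
    using power_sum_cong[OF p p5, of N] unfolding Nd by (intro cong_add cong_mult cong_refl)
  have eq: "3 * (int N - int c + s) + int p = (int p)\<^sup>2 + 3 * s" for s
  proof -
    have "y = 3 * a + 1 \<Longrightarrow> x = 3 * b + 1 \<Longrightarrow> 3 * (a - b + s) + x = y + 3 * s" for a b x y :: int
      by simp
    moreover have "(int p)\<^sup>2 = 3 * int N + 1" using N
      by (metis of_nat_1 of_nat_add of_nat_mult of_nat_numeral of_nat_power)
    moreover have "int p = 3 * int c + 1" using pc by simp
    ultimately show ?thesis by blast
  qed
  have "(int p)\<^sup>2 dvd 3 * (\<Sum>i\<le>N. int i ^ (p - 1)) + int p \<longleftrightarrow> (int p)\<^sup>2 dvd (int p)\<^sup>2 + 3 * ?S"
    using cg unfolding eq by (rule cong_dvd_iff)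
  also have "\<dots> \<longleftrightarrow> (int p)\<^sup>2 dvd ?S"
    using cop3 by (simp add: coprime_dvd_mult_right_iff)
  finally have two: "(int p)\<^sup>2 dvd 3 * (\<Sum>i\<le>N. int i ^ (p - 1)) + int p \<longleftrightarrow> (int p)\<^sup>2 dvd ?S" .
  define t where "t = 3 ^ (p - 1) * (3 * (\<Sum>i\<le>N. int i ^ (p - 1)) + int p)"
  have tt: "(int p)\<^sup>2 dvd t \<longleftrightarrow> (int p)\<^sup>2 dvd ?S"
    unfolding t_def two[symmetric] using cop3 by (simp add: coprime_dvd_mult_right_iff)
  have g: "p_divides p 2 (glaisher (p - 1) - of_int t)"
    unfolding t_def by (rule glaisher_cong[OF p p5 N])
  have "p_divides p 2 (glaisher (p - 1)) \<longleftrightarrow> p_divides p 2 (of_int t)"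
  proof
    assume "p_divides p 2 (glaisher (p - 1))"
    from p_divides_diff[OF p this g] show "p_divides p 2 (of_int t)" by simp
  next
    assume "p_divides p 2 (of_int t)"
    from p_divides_add[OF p g this] show "p_divides p 2 (glaisher (p - 1))" by simp
  qed
  then show ?thesis
    unfolding p_integral_cong_0_iff[OF p] p_divides_of_int_iff[OF p] one tt by simp
qed

lemma third_trunc_cong:
  assumes "p = 3 * c + 1"
  shows "[third_trunc p k = k * c] (mod (p - 1))"
proof (induction k)
  case (Suc k)
  have "[p = 1] (mod (p - 1))" using assms by (metis cong_altdef_nat dvd_refl le_add2)
  from cong_add[OF cong_mult[OF this Suc.IH] cong_refl[of c]] show ?case
    using assms by (simp add: add.commute)
qed simp

lemma cube_cong_1_iff:
  fixes y :: int
  assumes p: "Factorial_Ring.prime (p::nat)" and p5: "p \<ge> 5" and y: "int p dvd y - 1"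
  shows "[y ^ 3 = 1] (mod (int p)\<^sup>2) \<longleftrightarrow> [y = 1] (mod (int p)\<^sup>2)"
proof -
  have "\<not> int p dvd y\<^sup>2 + y + 1"
  proof
    assume "int p dvd y\<^sup>2 + y + 1"
    moreover have "y\<^sup>2 + y + 1 = (y - 1) * (y + 2) + 3" by (simp add: power2_eq_square algebra_simps)
    ultimately have "int p dvd 3" using y by (metis dvd_add_right_iff dvd_mult2)
    then have "int p \<le> 3" by (rule zdvd_imp_le) simp
    then show False using p5 by simp
  qed
  then have "coprime ((int p)\<^sup>2) (y\<^sup>2 + y + 1)" using p by (simp add: prime_imp_coprime)
  moreover have "y ^ 3 - 1 = (y - 1) * (y\<^sup>2 + y + 1)"
    by (simp add: power2_eq_square power3_eq_cube algebra_simps)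
  ultimately show ?thesis unfolding cong_iff_dvd_diff by (simp add: coprime_dvd_mult_left_iff)
qed

lemma (in Ring.field) add_pow_prime_power_eq_0:
  assumes "add_pow R (p ^ n :: nat) \<one> = \<zero>"
  shows "add_pow R p \<one> = \<zero>"
  using assms
proof (induction n)
  case (Suc n)
  have "add_pow R (p ^ Suc n) \<one> = add_pow R p \<one> \<otimes> add_pow R (p ^ n) \<one>"
    by (simp add: add_pow_ldistr add.nat_pow_pow mult.commute)
  then show ?case using Suc by (auto simp: integral_iff)
qed simp

lemma (in Ring.field) finite_field_generator:
  assumes card: "card (carrier R) = q" and q: "q > 1"
  obtains g where "g \<in> carrier R"
    "bij_betw (\<lambda>k::nat. g [^] k) {..<q - 1} (carrier R - {\<zero>})"
    "\<And>k::nat. g [^] k = \<one> \<longleftrightarrow> (q - 1) dvd k"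
proof -
  have fin: "finite (carrier R)" using card q by (intro card_ge_0_finite) simp
  then have fin': "finite (carrier (mult_of R))" by (rule finite_mult_of)
  interpret G: group "mult_of R" rewrites
      "([^]\<^bsub>mult_of R\<^esub>) = (([^]) :: _ \<Rightarrow> nat \<Rightarrow> _)" and "\<one>\<^bsub>mult_of R\<^esub> = \<one>"
    by (rule field_mult_group) (simp_all add: fun_eq_iff nat_pow_def mult_of_def)
  obtain g where g: "g \<in> carrier (mult_of R)" "carrier (mult_of R) = {g [^] i | i::nat. i \<in> UNIV}"
    using finite_field_mult_group_has_gen[OF fin] by blast
  have ord: "G.ord g \<ge> 1" by (rule G.ord_ge_1[OF fin' g(1)])
  have im: "carrier R - {\<zero>} = (\<lambda>k::nat. g [^] k) ` {0..G.ord g - 1}"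
    using g(2) G.ord_elems[OF fin' g(1)] by (auto simp: image_iff)
  have inj: "inj_on (\<lambda>k::nat. g [^] k) {0..G.ord g - 1}" by (rule G.ord_inj[OF g(1)])
  have "card (carrier R - {\<zero>}) = q - 1" using card fin by simp
  then have ordq: "G.ord g = q - 1" using card_image[OF inj] im ord by simp
  have "{0..G.ord g - 1} = {..<q - 1}" using ord ordq by auto
  then have "bij_betw (\<lambda>k::nat. g [^] k) {..<q - 1} (carrier R - {\<zero>})"
    using inj im by (simp add: bij_betw_def)
  moreover have "g [^] k = \<one> \<longleftrightarrow> (q - 1) dvd k" for k :: nat
    using G.pow_eq_id[OF g(1)] ordq by simp
  ultimately show thesis using g(1) by (intro that[of g]) auto
qed

text \<open>
  The unit-root Jacobi sum \<open>J\<close> (up to sign) equals the quotient of the central binomial coefficients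
  of \<open>(p\<^sup>p - 1)/3\<close> and \<open>(p - 1)/3\<close>, which modulo \<open>p\<^sup>2\<close> is \<open>P(N)\<^bsup>-3(p - 1)\<^esup>\<close>: there are \<open>p - 1\<close> steps between them,
  and the sign ambiguity of \<open>P(N) P(2N)\<close> disappears in an even power. Finally a number that is 1
  modulo \<open>p\<close> is 1 modulo \<open>p\<^sup>2\<close> as soon as its cube is.
\<close>
lemma card_weierstrass_points_cong_0_iff:
  assumes p: "Factorial_Ring.prime (p::nat)" and p5: "p \<ge> 5" and pc: "p = 3 * c + 1"
    and F: "field F" and card: "card (carrier F) = p ^ (p - 1)"
  shows "[card (weierstrass_points F \<zero>\<^bsub>F\<^esub> (\<ominus>\<^bsub>F\<^esub> \<one>\<^bsub>F\<^esub>)) = 0] (mod p\<^sup>2) \<longleftrightarrow> one_exceptional p 3"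
proof -
  interpret F: Ring.field F by (rule F)
  define q where "q = p ^ (p - 1)"
  define m where "m = third_trunc p (p - 1)"
  define m1 where "m1 = third_trunc p (p - 2)"
  define N where "N = third_trunc p 2"
  let ?P = "coprime_fact p"
  have cp: "(p - 1) div 3 = c" using pc by simp
  have p_odd: "odd p" using p5 by (intro prime_odd_nat p) simp
  then have c_even: "even c" using pc by auto
  have c0: "c > 0" using pc p5 by simp
  have qm: "q = 3 * m + 1" unfolding q_def m_def by (rule third_trunc_eq[OF pc, symmetric])
  have "p - 1 = Suc (p - 2)" using p5 by simp
  then have m: "m = p * m1 + c" unfolding m_def m1_def using cp by simp
  have Q: "p ^ (p - 2) = 3 * m1 + 1" unfolding m1_def by (rule third_trunc_eq[OF pc, symmetric])
  have "p - 2 = Suc (p - 3)" using p5 by simp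
  then have m1: "m1 > 0" unfolding m1_def using cp c0 by simp
  have pm: "p * m + c = third_trunc p p"
  proof -
    have "p = Suc (p - 1)" using p5 by simp
    then have "third_trunc p p = p * third_trunc p (p - 1) + (p - 1) div 3" by (metis third_trunc.simps(2))
    then show ?thesis unfolding m_def cp by simp
  qed
  have m_even: "even m" unfolding m_def using even_third_trunc c_even cp by simp
  have q_div: "p\<^sup>2 dvd q" unfolding q_def using p5 by (intro le_imp_power_dvd) simp
  have dvd_m: "(p - 1) dvd m"
  proof -
    have "[m = (p - 1) * c] (mod (p - 1))" unfolding m_def by (rule third_trunc_cong[OF pc])
    then show ?thesis by (metis cong_dvd_iff dvd_triv_left)
  qed
  have four: "4 dvd q - 1"
  proof -
    obtain h where h: "p - 1 = 2 * h" using p_odd by (metis odd_two_times_div_two_nat)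
    obtain k where k: "p = 2 * k + 1" using p_odd by (metis oddE)
    have "p\<^sup>2 = 1 + 4 * (k * k + k)" unfolding k power2_eq_square by (simp add: algebra_simps)
    then have "[p\<^sup>2 = 1] (mod 4)" by (simp add: Cong.cong_def)
    then have "[(p\<^sup>2) ^ h = 1 ^ h] (mod 4)" by (rule cong_pow)
    then have "[q = 1] (mod 4)" unfolding q_def h power_mult by simp
    then show ?thesis using qm by (metis cong_altdef_nat le_add2)
  qed
  have q1: "q > 1" using qm m c0 by simp
  obtain g where g: "g \<in> carrier F" "bij_betw (\<lambda>k::nat. g [^]\<^bsub>F\<^esub> k) {..<q - 1} (carrier F - {\<zero>\<^bsub>F\<^esub>})"
    "\<And>k::nat. g [^]\<^bsub>F\<^esub> k = \<one>\<^bsub>F\<^esub> \<longleftrightarrow> (q - 1) dvd k"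
    using F.finite_field_generator[OF card[folded q_def] q1] by blast
  have char: "add_pow F p \<one>\<^bsub>F\<^esub> = \<zero>\<^bsub>F\<^esub>"
  proof (rule F.add_pow_prime_power_eq_0)
    have "\<one>\<^bsub>F\<^esub> [^]\<^bsub>add_monoid F\<^esub> Coset.order (add_monoid F) = \<one>\<^bsub>add_monoid F\<^esub>"
      by (rule group.pow_order_eq_1[OF F.a_group]) simp
    then show "add_pow F (p ^ (p - 1)) \<one>\<^bsub>F\<^esub> = \<zero>\<^bsub>F\<^esub>"
      using card by (simp add: add_pow_def Coset.order_def)
  qed
  interpret E: finite_field_evaluation F p g q m
    by unfold_locales (use p char g card q_div qm m c0 p_odd in \<open>simp_all add: q_def\<close>)
  let ?E = "card (weierstrass_points F \<zero>\<^bsub>F\<^esub> (\<ominus>\<^bsub>F\<^esub> \<one>\<^bsub>F\<^esub>))"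
  define S1 where "S1 = (\<Sum>j<c. p * m choose ((3 * j + 2) * m))"
  define J where "J = (\<Sum>j\<le>2*c. p * (2 * m) choose ((3 * j + 1) * m))"
  have count: "[?E + S1 + J = 1] (mod p\<^sup>2)"
    unfolding S1_def J_def by (rule E.card_weierstrass_points_cong[OF pc dvd_m m_even four])
  have S1: "[S1 = 0] (mod p\<^sup>2)"
  proof -
    have "[S1 = (\<Sum>j<c. 0)] (mod p\<^sup>2)" unfolding S1_def
      by (intro cong_sum conjugate_jacobi_sum_term_cong_0[OF p pc refl Q m1 m]) simp
    then show ?thesis by simp
  qed
  have EJ: "[?E = 0] (mod p\<^sup>2) \<longleftrightarrow> [J = 1] (mod p\<^sup>2)"
  proof -
    have "[?E + J = ?E + S1 + J] (mod p\<^sup>2)"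
      using cong_add[OF cong_add[OF cong_refl[of ?E] cong_sym[OF S1]] cong_refl[of J]] by simp
    then have *: "[?E + J = 1] (mod p\<^sup>2)" using count by (rule cong_trans)
    show ?thesis
    proof
      assume "[?E = 0] (mod p\<^sup>2)"
      then have "[?E + J = 0 + J] (mod p\<^sup>2)" by (intro cong_add cong_refl)
      then show "[J = 1] (mod p\<^sup>2)" using * by (metis add_0 cong_sym cong_trans)
    next
      assume "[J = 1] (mod p\<^sup>2)"
      then have "[?E + J = ?E + 1] (mod p\<^sup>2)" by (intro cong_add cong_refl)
      then have "[?E + 1 = 0 + 1] (mod p\<^sup>2)" using * by (metis add_0 cong_sym cong_trans)
      then show "[?E = 0] (mod p\<^sup>2)" by (simp only: cong_add_rcancel_nat)
    qed
  qed
  have u: "coprime (2 * c choose c) (p\<^sup>2)"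
  proof -
    have "\<not> p dvd fact (2 * c)" using p pc by (simp add: prime_dvd_fact_iff)
    moreover have "(2 * c choose c) dvd fact (2 * c)"
      using binomial_fact_lemma[of c "2 * c"] by (metis dvd_triv_right le_add2 mult_2)
    ultimately have "\<not> p dvd (2 * c choose c)" using dvd_trans by blast
    then show ?thesis using p by (simp add: prime_imp_coprime coprime_commute)
  qed
  define X where "X = ?P N ^ (3 * (p - 1))"
  have JX: "[J * X = 1] (mod p\<^sup>2)"
  proof -
    have h: "p - 1 = 2 * ((p - 1) div 2)" using p_odd by simp
    have T: "[(?P N * ?P (2 * N)) ^ (p - 1) = 1] (mod p\<^sup>2)"
    proof -
      have "[((?P N * ?P (2 * N))\<^sup>2) ^ ((p - 1) div 2) = 1 ^ ((p - 1) div 2)] (mod p\<^sup>2)"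
        unfolding N_def by (intro cong_pow coprime_fact_third_mult[OF p pc])
      then show ?thesis using h by (metis power_mult power_one)
    qed
    have "[J * (2 * c choose c) * X = (2 * (p * m + c) choose (p * m + c)) * X] (mod p\<^sup>2)"
      unfolding J_def by (intro cong_mult cong_refl jacobi_sum_cong[OF p pc c0 refl Q m1 m])
    also have "[(2 * (p * m + c) choose (p * m + c)) * X
        = (?P N * ?P (2 * N)) ^ (p - 1) * (2 * c choose c)] (mod p\<^sup>2)"
    proof -
      have "p - 1 + 1 = p" using p5 by simp
      then show ?thesis
        using central_choose_third_trunc_cong[OF p pc c_even, of "p - 1"]
        unfolding pm X_def N_def by simp
    qed
    also have "[(?P N * ?P (2 * N)) ^ (p - 1) * (2 * c choose c) = 1 * (2 * c choose c)] (mod p\<^sup>2)"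
      by (intro cong_mult T cong_refl)
    finally have "[J * X * (2 * c choose c) = 1 * (2 * c choose c)] (mod p\<^sup>2)"
      by (simp only: mult_ac)
    then show ?thesis using u by (simp only: cong_mult_rcancel_nat)
  qed
  have JX1: "[J = 1] (mod p\<^sup>2) \<longleftrightarrow> [X = 1] (mod p\<^sup>2)"
  proof
    assume "[J = 1] (mod p\<^sup>2)"
    then have "[J * X = 1 * X] (mod p\<^sup>2)" by (intro cong_mult cong_refl)
    then show "[X = 1] (mod p\<^sup>2)" using JX by (metis cong_sym cong_trans mult_1)
  next
    assume "[X = 1] (mod p\<^sup>2)"
    then have "[J * X = J * 1] (mod p\<^sup>2)" by (intro cong_mult cong_refl)
    then show "[J = 1] (mod p\<^sup>2)" using JX by (metis cong_sym cong_trans mult_1_right)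
  qed
  have "[X = 1] (mod p\<^sup>2) \<longleftrightarrow> [?P N ^ (p - 1) = 1] (mod p\<^sup>2)"
  proof -
    define y where "y = int (?P N ^ (p - 1))"
    have "\<not> p dvd ?P N"
      using coprime_coprime_fact[of p N] p by (metis coprime_absorb_right not_prime_unit)
    then have "[y = int 1] (mod int p)" unfolding y_def cong_int_iff by (rule fermat_theorem[OF p])
    then have "int p dvd y - 1" by (simp add: cong_iff_dvd_diff)
    from cube_cong_1_iff[OF p p5 this]
    have "[int X = int 1] (mod int (p\<^sup>2)) \<longleftrightarrow> [int (?P N ^ (p - 1)) = int 1] (mod int (p\<^sup>2))"
      unfolding X_def y_def by (simp add: power_mult[symmetric] mult.commute)
    then show ?thesis unfolding cong_int_iff .
  qed
  moreover have "?P N ^ (p - 1) = (\<Prod>a | 1 \<le> a \<and> a \<le> (p\<^sup>2 - 1) div 3 \<and> coprime a p. a ^ (p - 1))"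
  proof -
    have "3 * N + 1 = p\<^sup>2" unfolding N_def by (rule third_trunc_eq[OF pc])
    then have "(p\<^sup>2 - 1) div 3 = N" by linarith
    then show ?thesis by (simp only: coprime_fact_def prod_power_distrib)
  qed
  ultimately show ?thesis unfolding EJ JX1 one_exceptional_def by simp
qed

theorem proposition5p1:
  fixes p q :: nat
  assumes "Factorial_Ring.prime p"
    and "[p = 1] (mod 3)"
    and "q = p ^ (p - 1)"
  shows "(one_exceptional p 3 \<longleftrightarrow> p_integral_cong p (glaisher (p - 1)) 0 (p^2)) \<and>
    (\<forall>F :: ('a, 'b) ring_scheme. field F \<and> card (carrier F) = q \<longrightarrow>
       (p_integral_cong p (glaisher (p - 1)) 0 (p^2) \<longleftrightarrow>
        [card (weierstrass_points F \<zero>\<^bsub>F\<^esub> (\<ominus>\<^bsub>F\<^esub> \<one>\<^bsub>F\<^esub>)) = 0] (mod p^2)))"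
proof -
  have "p mod 3 = 1" using assms(2) by (simp add: Cong.cong_def)
  then have pc: "p = 3 * (p div 3) + 1" by presburger
  have "p \<noteq> 1" using assms(1) by auto
  moreover have "p \<noteq> 4"
  proof
    assume "p = 4"
    then show False using assms(1) prime_nat_iff[of p] by (auto dest: spec[of _ 2])
  qed
  ultimately have p5: "p \<ge> 5" using pc prime_ge_2_nat[OF assms(1)] by presburger
  show ?thesis
    using one_exceptional_iff_glaisher[OF assms(1) p5 pc]
      card_weierstrass_points_cong_0_iff[OF assms(1) p5 pc] assms(3) by blast
qed

end
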